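(* Let $p\in\mathbb{C}[z]$ be a nonconstant polynomial with only simple zeros and let $Z_p=\{(x,y,z)\in\mathbb{C}^3 : xy=p(z)\}$ be the corresponding smooth Danielewski surface. The group generated by the unipotent groups (flows) corresponding to the four locally nilpotent derivations $V,\ W,\ yV,\ xW$ acts infinitely transitively on $Z_p$.
   Context: On $Z_p$: $V=p'(z)\frac{\partial}{\partial x}+y\frac{\partial}{\partial z}$ and $W=p'(z)\frac{\partial}{\partial y}+x\frac{\partial}{\partial z}$. The unipotent group corresponding to a locally nilpotent derivation $\Theta$ is its one-parameter flow group $\{\exp(t\Theta):t\in\mathbb{C}\}$ of algebraic automorphisms of $Z_p$. A group $G$ acting by automorphisms on a complex variety $X$ acts infinitely transitively if it acts $m$-transitively on the regular part $X_{\mathrm{reg}}$ for every $m\in\mathbb{N}$, i.e. any $m$-tuple of pairwise distinct points of $X_{\mathrm{reg}}$ can be mapped to any other such $m$-tuple by an element of $G$.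
   Formalization: "Nonconstant" is replaced by "degree at least 2": for degree 1 the surface is an affine plane on which all four flows are affine maps of determinant 1, so the group preserves triangle areas and is not 3-transitive. *)

theory Defs
  imports
    "HOL-Analysis.Analysis"
    "HOL-Algebra.Bij"
    "HOL-Algebra.Generated_Groups"
    "HOL-Computational_Algebra.Polynomial"
begin

type_synonym C3 = "complex \<times> complex \<times> complex"

definition Zp :: "complex poly \<Rightarrow> C3 set" where
  "Zp p = {(x, y, z). x * y = poly p z}"

text \<open>Regular points of \<open>Zp p\<close> by the Jacobian criterion: the gradient
  \<open>(y, x, - p'(z))\<close> of \<open>x * y - p(z)\<close> does not vanish.\<close>

definition Zp_reg :: "complex poly \<Rightarrow> C3 set" where
  "Zp_reg p = {(x, y, z) \<in> Zp p. (y, x, - poly (pderiv p) z) \<noteq> (0, 0, 0)}"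

lemma Zp_reg_eq: "rsquarefree p \<Longrightarrow> Zp_reg p = Zp p"
  unfolding Zp_reg_def Zp_def by (auto simp: rsquarefree_roots)

text \<open>A derivation is represented by the operator that it induces on functions on the ambient
  space. The two derivations below annihilate \<open>x * y - p(z)\<close>, hence they are tangent to
  \<open>Zp p\<close> and restrict to derivations of its coordinate ring. The partial derivatives are
  complex derivatives.\<close>

type_synonym derivation = "(C3 \<Rightarrow> complex) \<Rightarrow> (C3 \<Rightarrow> complex)"

definition crd_x :: "C3 \<Rightarrow> complex" where "crd_x = (\<lambda>(x, y, z). x)"
definition crd_y :: "C3 \<Rightarrow> complex" where "crd_y = (\<lambda>(x, y, z). y)"
definition crd_z :: "C3 \<Rightarrow> complex" where "crd_z = (\<lambda>(x, y, z). z)"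

lemma crd_simps [simp]: "crd_x (x, y, z) = x" "crd_y (x, y, z) = y" "crd_z (x, y, z) = z"
  by (simp_all add: crd_x_def crd_y_def crd_z_def)

definition d_x :: derivation where "d_x f = (\<lambda>(x, y, z). deriv (\<lambda>s. f (s, y, z)) x)"
definition d_y :: derivation where "d_y f = (\<lambda>(x, y, z). deriv (\<lambda>s. f (x, s, z)) y)"
definition d_z :: derivation where "d_z f = (\<lambda>(x, y, z). deriv (\<lambda>s. f (x, y, s)) z)"

definition V_der :: "complex poly \<Rightarrow> derivation" where
  "V_der p f = (\<lambda>q. poly (pderiv p) (crd_z q) * d_x f q + crd_y q * d_z f q)"

definition W_der :: "complex poly \<Rightarrow> derivation" where
  "W_der p f = (\<lambda>q. poly (pderiv p) (crd_z q) * d_y f q + crd_x q * d_z f q)"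

definition scale_der :: "(C3 \<Rightarrow> complex) \<Rightarrow> derivation \<Rightarrow> derivation" where
  "scale_der h \<Theta> f = (\<lambda>q. h q * \<Theta> f q)"

text \<open>\<open>exp (t \<Theta>)\<close> applied to a function. For a locally nilpotent \<open>\<Theta>\<close> and a polynomial function the
  series has only finitely many nonzero terms.\<close>

definition exp_der :: "complex \<Rightarrow> derivation \<Rightarrow> (C3 \<Rightarrow> complex) \<Rightarrow> C3 \<Rightarrow> complex" where
  "exp_der t \<Theta> f q = (\<Sum>k. t ^ k / fact k * (\<Theta> ^^ k) f q)"

text \<open>The map of points whose pullback on functions is \<open>exp (t \<Theta>)\<close>, i.e. the time \<open>t\<close> flow
  map of \<open>\<Theta>\<close>.\<close>

definition flow_map :: "derivation \<Rightarrow> complex \<Rightarrow> C3 \<Rightarrow> C3" where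
  "flow_map \<Theta> t q = (exp_der t \<Theta> crd_x q, exp_der t \<Theta> crd_y q, exp_der t \<Theta> crd_z q)"

definition unipotent_group :: "complex poly \<Rightarrow> derivation \<Rightarrow> (C3 \<Rightarrow> C3) set" where
  "unipotent_group p \<Theta> = range (\<lambda>t. restrict (flow_map \<Theta> t) (Zp p))"

definition four_derivations :: "complex poly \<Rightarrow> derivation set" where
  "four_derivations p =
     {V_der p, W_der p, scale_der crd_y (V_der p), scale_der crd_x (W_der p)}"

definition flow_group :: "complex poly \<Rightarrow> (C3 \<Rightarrow> C3) set" where
  "flow_group p =
     generate (BijGroup (Zp p)) (\<Union>\<Theta>\<in>four_derivations p. unipotent_group p \<Theta>)"

definition m_transitive :: "nat \<Rightarrow> ('a \<Rightarrow> 'a) set \<Rightarrow> 'a set \<Rightarrow> bool" where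
  "m_transitive m G S \<longleftrightarrow>
     (\<forall>as bs. length as = m \<and> distinct as \<and> set as \<subseteq> S \<and>
              length bs = m \<and> distinct bs \<and> set bs \<subseteq> S \<longrightarrow> (\<exists>g\<in>G. map g as = bs))"

text \<open>To be applied to the regular part \<open>S\<close> of a variety on which \<open>G\<close> acts.\<close>

definition infinitely_transitive :: "('a \<Rightarrow> 'a) set \<Rightarrow> 'a set \<Rightarrow> bool" where
  "infinitely_transitive G S \<longleftrightarrow> (\<forall>m. m_transitive m G S)"

subsection \<open>The exceptional case of degree 1\<close>

text \<open>If \<open>degree p = 1\<close>, then \<open>Zp p\<close> is the affine plane with coordinates \<open>x, y\<close>, and all
  four flows are affine maps of that plane of determinant 1. They preserve the area of the
  triangle spanned by three points, so the group is not 3-transitive. For this reason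
  infinite transitivity can only be claimed for \<open>degree p \<ge> 2\<close>.\<close>

definition tri_area :: "C3 \<Rightarrow> C3 \<Rightarrow> C3 \<Rightarrow> complex" where
  "tri_area u v w = (crd_x v - crd_x u) * (crd_y w - crd_y u)
                  - (crd_x w - crd_x u) * (crd_y v - crd_y u)"

lemma exp_der_quadratic:
  assumes "\<Theta> (\<Theta> f) = (\<lambda>_. 0)" "\<Theta> (\<lambda>_. 0) = (\<lambda>_. 0)"
  shows "exp_der t \<Theta> f q = f q + t * \<Theta> f q"
proof -
  have z: "(\<Theta> ^^ (k + 2)) f = (\<lambda>_. 0)" for k
    by (induction k) (simp_all add: assms)
  have "(\<Sum>k. t ^ k / fact k * (\<Theta> ^^ k) f q) = (\<Sum>k<2. t ^ k / fact k * (\<Theta> ^^ k) f q)"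
  proof (rule suminf_finite)
    fix k :: nat assume "k \<notin> {..<2}"
    then obtain j where "k = j + 2" by (metis le_add_diff_inverse2 lessThan_iff not_less)
    then show "t ^ k / fact k * (\<Theta> ^^ k) f q = 0" using z[of j] by simp
  qed simp
  then show ?thesis by (simp add: exp_der_def numeral_2_eq_2)
qed

lemmas der_defs = V_der_def W_der_def scale_der_def d_x_def d_y_def d_z_def
  crd_x_def crd_y_def crd_z_def

lemma flow_map_degree_1:
  fixes a b :: complex
  defines "p \<equiv> [:b, a:]"
  shows "flow_map (V_der p) t (x, y, z) = (x + t * a, y, z + t * y)"
    and "flow_map (W_der p) t (x, y, z) = (x, y + t * a, z + t * x)"
    and "flow_map (scale_der crd_y (V_der p)) t (x, y, z) = (x + t * (a * y), y, z + t * y\<^sup>2)"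
    and "flow_map (scale_der crd_x (W_der p)) t (x, y, z) = (x, y + t * (a * x), z + t * x\<^sup>2)"
  unfolding flow_map_def
  by (subst (1 2 3) exp_der_quadratic;
      simp add: p_def der_defs pderiv_pCons split_def fun_eq_iff power2_eq_square)+

lemma flow_map_Bij_degree_1:
  fixes a b :: complex
  defines "p \<equiv> [:b, a:]"
  assumes "\<Theta> \<in> four_derivations p"
  shows "restrict (flow_map \<Theta> t) (Zp p) \<in> Bij (Zp p)"
proof -
  have maps: "flow_map \<Theta> t q \<in> Zp p" if "q \<in> Zp p" for t q
    using that assms(2) unfolding p_def
    by (cases q) (auto simp: four_derivations_def flow_map_degree_1 Zp_def algebra_simps
        power2_eq_square)
  have inv: "flow_map \<Theta> s (flow_map \<Theta> t q) = q" if "s = - t" for s t q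
    using that assms(2) unfolding p_def
    by (cases q) (auto simp: four_derivations_def flow_map_degree_1 algebra_simps)
  have "bij_betw (flow_map \<Theta> t) (Zp p) (Zp p)"
    by (rule bij_betw_byWitness[where f' = "flow_map \<Theta> (- t)"]) (auto simp: inv maps)
  then show ?thesis by (auto simp: Bij_def bij_betw_restrict_eq)
qed

lemma flow_group_degree_1:
  fixes a b :: complex
  defines "p \<equiv> [:b, a:]"
  assumes "g \<in> flow_group p"
  shows "g \<in> Bij (Zp p) \<and>
    (\<forall>u\<in>Zp p. \<forall>v\<in>Zp p. \<forall>w\<in>Zp p. tri_area (g u) (g v) (g w) = tri_area u v w)"
proof -
  have gen: "h \<in> Bij (Zp p) \<and>
      (\<forall>u\<in>Zp p. \<forall>v\<in>Zp p. \<forall>w\<in>Zp p. tri_area (h u) (h v) (h w) = tri_area u v w)"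
    if "h \<in> (\<Union>\<Theta>\<in>four_derivations p. unipotent_group p \<Theta>)" for h
  proof -
    from that obtain \<Theta> t where \<Theta>: "\<Theta> \<in> four_derivations p"
        and h: "h = restrict (flow_map \<Theta> t) (Zp p)"
      by (auto simp: unipotent_group_def)
    have "tri_area (flow_map \<Theta> t u) (flow_map \<Theta> t v) (flow_map \<Theta> t w) = tri_area u v w" for u v w
      using \<Theta> unfolding p_def
      by (cases u; cases v; cases w) (auto simp: four_derivations_def flow_map_degree_1
          tri_area_def algebra_simps)
    then show ?thesis using flow_map_Bij_degree_1 \<Theta> h unfolding p_def by auto
  qed
  from assms(2) show ?thesis unfolding flow_group_def
  proof (induction rule: generate.induct)
    case one
    have eq: "\<one>\<^bsub>BijGroup (Zp p)\<^esub> = (\<lambda>x\<in>Zp p. x)" by (simp add: BijGroup_def)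
    show ?case unfolding eq by (intro conjI ballI, rule id_Bij) simp
  next
    case (incl h)
    then show ?case by (rule gen)
  next
    case (inv h)
    note h = gen[OF inv]
    have eq: "inv\<^bsub>BijGroup (Zp p)\<^esub> h = restrict (inv_into (Zp p) h) (Zp p)"
      using h by (simp add: inv_BijGroup)
    have im: "h ` Zp p = Zp p" using h by (auto simp: Bij_def bij_betw_def)
    have 1: "inv_into (Zp p) h u \<in> Zp p" "h (inv_into (Zp p) h u) = u" if "u \<in> Zp p" for u
      using that im inv_into_into[of u h "Zp p"] f_inv_into_f[of u h "Zp p"] by auto
    show ?case unfolding eq
    proof (intro conjI ballI)
      show "restrict (inv_into (Zp p) h) (Zp p) \<in> Bij (Zp p)"
        using h restrict_inv_into_Bij by blast
    next
      fix u v w assume uvw: "u \<in> Zp p" "v \<in> Zp p" "w \<in> Zp p"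
      let ?i = "inv_into (Zp p) h"
      have "tri_area (h (?i u)) (h (?i v)) (h (?i w)) = tri_area (?i u) (?i v) (?i w)"
        using h 1 uvw by blast
      then show "tri_area (restrict ?i (Zp p) u) (restrict ?i (Zp p) v) (restrict ?i (Zp p) w)
          = tri_area u v w"
        using 1 uvw by simp
    qed
  next
    case (eng g h)
    then have "g \<in> Bij (Zp p)" "h \<in> Bij (Zp p)" by auto
    then have eq: "g \<otimes>\<^bsub>BijGroup (Zp p)\<^esub> h = compose (Zp p) g h"
      by (simp add: BijGroup_def)
    have "h u \<in> Zp p" if "u \<in> Zp p" for u
      using that \<open>h \<in> Bij (Zp p)\<close> Bij_imp_funcset by blast
    with eng.IH show ?case unfolding eq
      by (simp add: compose_Bij) (simp add: compose_def)
  qed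
qed

lemma not_infinitely_transitive_degree_1:
  fixes p :: "complex poly"
  assumes "degree p = 1"
  shows "\<not> infinitely_transitive (flow_group p) (Zp_reg p)"
proof
  assume tr: "infinitely_transitive (flow_group p) (Zp_reg p)"
  obtain a b where p: "p = [:b, a:]" and a: "a \<noteq> 0"
    using degree1_coeffs[OF assms] by metis
  define P where "P = (\<lambda>x y. (x, y, (x * y - b) / a))"
  have P: "P x y \<in> Zp p" "P x y \<in> Zp_reg p" for x y
    using a by (auto simp: P_def Zp_reg_def Zp_def p pderiv_pCons)
  let ?as = "[P 0 0, P 1 0, P 2 0]" and ?bs = "[P 0 0, P 1 0, P 0 1]"
  have "m_transitive 3 (flow_group p) (Zp_reg p)"
    using tr by (simp add: infinitely_transitive_def)
  moreover have "length ?as = 3" "distinct ?as" "set ?as \<subseteq> Zp_reg p"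
    "length ?bs = 3" "distinct ?bs" "set ?bs \<subseteq> Zp_reg p"
    by (simp_all add: P(2)) (simp_all add: P_def)
  ultimately obtain g where g: "g \<in> flow_group p" "map g ?as = ?bs"
    unfolding m_transitive_def by meson
  have "tri_area (g (P 0 0)) (g (P 1 0)) (g (P 2 0)) = tri_area (P 0 0) (P 1 0) (P 2 0)"
    using flow_group_degree_1[of g b a] g(1) P(1) unfolding p by blast
  then show False using g(2) by (simp add: tri_area_def P_def)
qed

end

theory Submission
  imports Defs "HOL-Computational_Algebra.Fundamental_Theorem_Algebra"
begin

text \<open>The flows preserve the Poisson bracket with Casimir function \<open>x y - p z\<close>. Call a polynomial
  \<open>K\<close> a Hamiltonian of the group if its Hamiltonian vector field is the velocity at \<open>s = 0\<close> of a
  polynomial family \<open>h s\<close> of group elements with \<open>h 0 = id\<close>. Hamiltonians form a vector space that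
  contains \<open>y\<close> and is stable under composition with group elements, hence also under extracting the
  coefficients of the polynomial \<open>t \<mapsto> K \<circ> exp (t \<Theta>)\<close>. Starting from \<open>y\<close> this yields
  \<open>y ^ k p' z\<close> and then, by differentiating in \<open>z\<close>, all sufficiently high powers \<open>y ^ n\<close> and the
  products \<open>y ^ n z\<close>; here \<open>degree p \<ge> 2\<close> is needed. By interpolation in \<open>y\<close> the Hamiltonian fields
  realise every tangent vector of an \<open>m\<close>-tuple whose \<open>y\<close>-coordinates are distinct and nonzero, so
  the orbits on such generic tuples are open. Generic tuples form a connected set, so they are one
  orbit. Finally every tuple of distinct points can be moved to a generic one: a flow of \<open>V\<close> makes
  all \<open>x\<close>-coordinates nonzero, and a flow of \<open>(a + b x) W\<close> separates the \<open>y\<close>-coordinates.\<close>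

subsection \<open>Algebras of functions generated by coordinates\<close>

text \<open>Velocities of families replace Lie brackets: the flows preserve the bracket, so
  substituting a flow into a Hamiltonian stays inside the class, and the coefficients of the time do
  what iterated brackets would do. \<open>V\<close> shifts \<open>z\<close> by \<open>t y\<close>
  and \<open>y V\<close> shifts it by \<open>t y ^ 2\<close>, so \<open>j\<close> derivatives in
  \<open>z\<close> can be bought with any number of factors \<open>y\<close> between
  \<open>j\<close> and \<open>2 j\<close>. The derivative of \<open>p\<close> itself comes from one
  use of \<open>W\<close>, which costs a factor \<open>y\<close>. Using up all derivatives of
  \<open>p\<close> turns \<open>y ^ n\<close> into \<open>y ^ (n - 1 + a + 2 b)\<close> with
  \<open>a + b = degree p - 1\<close>; in degree 1 the exponent could only drop. Hamiltonians
  \<open>C(y) z + E(y)\<close> suffice because \<open>y\<close> and \<open>z\<close> are coordinates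
  where \<open>y\<close> is nonzero, and there the missing low powers are harmless, since a factor
  \<open>y ^ N\<close> can be absorbed into the interpolation data. Simple zeros matter because
  \<open>V\<close> moves a point with \<open>y = 0\<close> exactly when \<open>p' z\<close> is
  nonzero. The commuting flows of \<open>V\<close> and \<open>y V\<close> are merged into one family
  with two parameters, as two are needed to steer two points independently.\<close>

inductive_set polyfun :: "('a \<Rightarrow> complex) set \<Rightarrow> ('a \<Rightarrow> complex) set" for B where
  const: "(\<lambda>_. c) \<in> polyfun B"
| base: "b \<in> B \<Longrightarrow> b \<in> polyfun B"
| add: "f \<in> polyfun B \<Longrightarrow> g \<in> polyfun B \<Longrightarrow> (\<lambda>u. f u + g u) \<in> polyfun B"
| mult: "f \<in> polyfun B \<Longrightarrow> g \<in> polyfun B \<Longrightarrow> (\<lambda>u. f u * g u) \<in> polyfun B"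

lemma polyfun_minus:
  assumes "f \<in> polyfun B" shows "(\<lambda>u. - f u) \<in> polyfun B"
  using polyfun.mult[OF polyfun.const[of "-1"] assms] by simp

lemma polyfun_diff:
  assumes "f \<in> polyfun B" "g \<in> polyfun B" shows "(\<lambda>u. f u - g u) \<in> polyfun B"
  using polyfun.add[OF assms(1) polyfun_minus[OF assms(2)]] by simp

lemma polyfun_sum:
  assumes "\<And>i. i \<in> I \<Longrightarrow> f i \<in> polyfun B" shows "(\<lambda>u. \<Sum>i\<in>I. f i u) \<in> polyfun B"
  using assms
  by (induction I rule: infinite_finite_induct) (auto intro: polyfun.const polyfun.add)

lemma polyfun_power:
  assumes "f \<in> polyfun B" shows "(\<lambda>u. f u ^ n) \<in> polyfun B"
  by (induction n) (auto intro: polyfun.const polyfun.mult assms)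

lemma polyfun_poly:
  assumes "f \<in> polyfun B" shows "(\<lambda>u. poly r (f u)) \<in> polyfun B"
proof (induction r)
  case (pCons a r)
  show ?case using polyfun.add[OF polyfun.const polyfun.mult[OF assms pCons.IH]] by simp
qed (use polyfun.const[of 0] in simp)

lemmas polyfun_intros = polyfun.const polyfun.base polyfun.add polyfun.mult polyfun_minus
  polyfun_diff polyfun_sum polyfun_power polyfun_poly

lemma polyfun_subst:
  assumes "f \<in> polyfun B" "\<And>b. b \<in> B \<Longrightarrow> (\<lambda>u. b (\<phi> u)) \<in> polyfun B'"
  shows "(\<lambda>u. f (\<phi> u)) \<in> polyfun B'"
  using assms by (induction rule: polyfun.induct) (auto intro: polyfun_intros)

lemma polyfun_tendsto:
  assumes "f \<in> polyfun B" "\<And>b. b \<in> B \<Longrightarrow> (b \<longlongrightarrow> b P) F"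
  shows "(f \<longlongrightarrow> f P) F"
  using assms by (induction rule: polyfun.induct) (auto intro: tendsto_const tendsto_add tendsto_mult)

text \<open>Closeness is measured by the functions in \<open>B\<close> alone, as \<open>'a\<close>
  carries no topology here. The boxes \<open>N \<delta>\<close> form a filter base, and
  \<open>polyfun_tendsto\<close> for this filter is the epsilon-delta claim.\<close>

lemma polyfun_bound:
  assumes "f \<in> polyfun B" "\<epsilon> > 0"
  shows "\<exists>\<delta>>0. \<forall>u. (\<forall>b\<in>B. cmod (b u - b P) < \<delta>) \<longrightarrow> cmod (f u - f P) < \<epsilon>"
proof -
  define N where "N = (\<lambda>\<delta>::real. {u. \<forall>b\<in>B. cmod (b u - b P) < \<delta>})"
  define F where "F = (INF \<delta>\<in>{0<..}. principal (N \<delta>))"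
  have ev: "eventually R F \<longleftrightarrow> (\<exists>\<delta>>0. \<forall>u\<in>N \<delta>. R u)" for R
  proof -
    have "eventually R F \<longleftrightarrow> (\<exists>\<delta>\<in>{0<..}. eventually R (principal (N \<delta>)))"
      unfolding F_def
    proof (rule eventually_INF_base)
      fix a b :: real assume "a \<in> {0<..}" "b \<in> {0<..}"
      then show "\<exists>x\<in>{0<..}. principal (N x) \<le> inf (principal (N a)) (principal (N b))"
        by (intro bexI[of _ "min a b"]) (auto simp: N_def)
    qed auto
    then show ?thesis by (auto simp: eventually_principal)
  qed
  have "(b \<longlongrightarrow> b P) F" if "b \<in> B" for b
    unfolding tendsto_iff ev using that by (auto simp: N_def dist_norm)
  from polyfun_tendsto[OF assms(1) this]
  have "eventually (\<lambda>u. dist (f u) (f P) < \<epsilon>) F"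
    using assms(2) by (simp add: tendsto_iff)
  then show ?thesis unfolding ev by (auto simp: N_def dist_norm)
qed

text \<open>Generators for polynomial functions of a pair of points, the home of difference
  quotients.\<close>

definition doubled :: "('a \<Rightarrow> complex) set \<Rightarrow> ('a \<times> 'a \<Rightarrow> complex) set" where
  "doubled B = (\<lambda>b w. b (fst w)) ` B \<union> (\<lambda>b w. b (snd w)) ` B"

lemma polyfun_doubled:
  assumes "f \<in> polyfun B"
  shows "(\<lambda>w. f (fst w)) \<in> polyfun (doubled B)" "(\<lambda>w. f (snd w)) \<in> polyfun (doubled B)"
  by (rule polyfun_subst[OF assms], rule polyfun.base, simp add: doubled_def)+

text \<open>Hadamard's lemma in algebraic form; the product case telescopes through the mixed term
  \<open>f v * g u\<close>. The quotients depend on both points because a contraction estimate has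
  to compare two arbitrary points.\<close>

lemma polyfun_hadamard:
  assumes "f \<in> polyfun B" "finite B"
  shows "\<exists>Q. (\<forall>b\<in>B. Q b \<in> polyfun (doubled B)) \<and>
    (\<forall>u v. f u - f v = (\<Sum>b\<in>B. (b u - b v) * Q b (u, v)))"
  using assms(1)
proof (induction rule: polyfun.induct)
  case (const c)
  show ?case by (rule exI[of _ "\<lambda>b w. 0"]) (auto intro: polyfun_intros)
next
  case (base b)
  have "(\<Sum>b'\<in>B. (b' u - b' v) * (if b' = b then 1 else 0)) = b u - b v" for u v
    using base assms(2) by (simp add: if_distrib cong: if_cong)
  then show ?case
    by (intro exI[of _ "\<lambda>b' w. if b' = b then 1 else 0"]) (auto intro: polyfun_intros)
next
  case (add f g)
  then obtain Q R where Q: "\<forall>b\<in>B. Q b \<in> polyfun (doubled B)"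
      "\<forall>u v. f u - f v = (\<Sum>b\<in>B. (b u - b v) * Q b (u, v))"
    and R: "\<forall>b\<in>B. R b \<in> polyfun (doubled B)"
      "\<forall>u v. g u - g v = (\<Sum>b\<in>B. (b u - b v) * R b (u, v))" by blast
  have "f u + g u - (f v + g v) = (\<Sum>b\<in>B. (b u - b v) * (Q b (u, v) + R b (u, v)))" for u v
  proof -
    have "f u + g u - (f v + g v) = (f u - f v) + (g u - g v)" by simp
    then show ?thesis unfolding Q(2)[rule_format, of u v] R(2)[rule_format, of u v]
      by (simp add: distrib_left sum.distrib)
  qed
  with Q(1) R(1) show ?case
    by (intro exI[of _ "\<lambda>b w. Q b w + R b w"]) (simp add: polyfun.add)
next
  case (mult f g)
  then obtain Q R where Q: "\<forall>b\<in>B. Q b \<in> polyfun (doubled B)"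
      "\<forall>u v. f u - f v = (\<Sum>b\<in>B. (b u - b v) * Q b (u, v))"
    and R: "\<forall>b\<in>B. R b \<in> polyfun (doubled B)"
      "\<forall>u v. g u - g v = (\<Sum>b\<in>B. (b u - b v) * R b (u, v))" by blast
  have "f u * g u - f v * g v
      = (\<Sum>b\<in>B. (b u - b v) * (Q b (u, v) * g u + f v * R b (u, v)))" for u v
  proof -
    have "f u * g u - f v * g v = (f u - f v) * g u + f v * (g u - g v)"
      by (simp add: algebra_simps)
    also have "\<dots> = (\<Sum>b\<in>B. (b u - b v) * Q b (u, v)) * g u
        + f v * (\<Sum>b\<in>B. (b u - b v) * R b (u, v))"
      using Q(2)[rule_format, of u v] R(2)[rule_format, of u v] by metis
    also have "\<dots> = (\<Sum>b\<in>B. (b u - b v) * (Q b (u, v) * g u + f v * R b (u, v)))"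
      by (simp add: distrib_left sum_distrib_left sum_distrib_right sum.distrib mult_ac)
    finally show ?thesis .
  qed
  moreover have "(\<lambda>w. Q b w * g (fst w) + f (snd w) * R b w) \<in> polyfun (doubled B)" if "b \<in> B" for b
    using Q(1) R(1) that
    by (intro polyfun.add polyfun.mult polyfun_doubled mult.hyps) auto
  ultimately show ?case
    by (intro exI[of _ "\<lambda>b w. Q b w * g (fst w) + f (snd w) * R b w"] conjI ballI allI)
      (assumption, simp only: fst_conv snd_conv)
qed

text \<open>A differential encoded by its chain rule along curves. A curve is only asked to have
  differentiable coordinates in \<open>B\<close>, so this makes sense over any type
  \<open>'a\<close>.\<close>

definition gradient_at :: "('a \<Rightarrow> complex) set \<Rightarrow> 'a \<Rightarrow> (('a \<Rightarrow> complex) \<Rightarrow> complex) \<Rightarrow> ('a \<Rightarrow> complex) \<Rightarrow> bool" where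
  "gradient_at B P c f \<longleftrightarrow> (\<forall>\<gamma> \<gamma>' s. \<gamma> s = P \<longrightarrow>
    (\<forall>b\<in>B. ((\<lambda>s. b (\<gamma> s)) has_field_derivative \<gamma>' b) (at s)) \<longrightarrow>
    ((\<lambda>s. f (\<gamma> s)) has_field_derivative (\<Sum>b\<in>B. c b * \<gamma>' b)) (at s))"

lemma gradient_atD:
  assumes "gradient_at B P c f" "\<gamma> s = P"
    "\<And>b. b \<in> B \<Longrightarrow> ((\<lambda>s. b (\<gamma> s)) has_field_derivative \<gamma>' b) (at s)"
  shows "((\<lambda>s. f (\<gamma> s)) has_field_derivative (\<Sum>b\<in>B. c b * \<gamma>' b)) (at s)"
  using assms unfolding gradient_at_def by blast

lemma polyfun_gradient:
  assumes "f \<in> polyfun B" "finite B"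
  shows "\<exists>c. gradient_at B P c f"
  using assms(1)
proof (induction rule: polyfun.induct)
  case (const c)
  show ?case by (rule exI[of _ "\<lambda>b. 0"]) (simp add: gradient_at_def)
next
  case (base b)
  have "(\<Sum>b'\<in>B. (if b' = b then 1 else 0) * \<gamma>' b') = \<gamma>' b" for \<gamma>' :: "_ \<Rightarrow> complex"
    using base assms(2) by (simp add: if_distrib if_distribR cong: if_cong)
  then show ?case using base
    by (intro exI[of _ "\<lambda>b'. if b' = b then 1 else 0"]) (simp add: gradient_at_def)
next
  case (add f g)
  then obtain c d where c: "gradient_at B P c f" and d: "gradient_at B P d g" by blast
  show ?case unfolding gradient_at_def
  proof (intro exI[of _ "\<lambda>b. c b + d b"] allI impI)
    fix \<gamma> \<gamma>' and s :: complex assume \<gamma>: "\<gamma> s = P"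
      "\<forall>b\<in>B. ((\<lambda>s. b (\<gamma> s)) has_field_derivative \<gamma>' b) (at s)"
    note D = DERIV_add[OF gradient_atD[where \<gamma>=\<gamma> and \<gamma>'=\<gamma>' and s=s, OF c \<gamma>(1) bspec[OF \<gamma>(2)]] gradient_atD[where \<gamma>=\<gamma> and \<gamma>'=\<gamma>' and s=s, OF d \<gamma>(1) bspec[OF \<gamma>(2)]]]
    show "((\<lambda>s. f (\<gamma> s) + g (\<gamma> s)) has_field_derivative
        (\<Sum>b\<in>B. (c b + d b) * \<gamma>' b)) (at s)"
      using D by (simp add: distrib_right sum.distrib)
  qed
next
  case (mult f g)
  then obtain c d where c: "gradient_at B P c f" and d: "gradient_at B P d g" by blast
  show ?case unfolding gradient_at_def
  proof (intro exI[of _ "\<lambda>b. c b * g P + f P * d b"] allI impI)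
    fix \<gamma> \<gamma>' and s :: complex assume \<gamma>: "\<gamma> s = P"
      "\<forall>b\<in>B. ((\<lambda>s. b (\<gamma> s)) has_field_derivative \<gamma>' b) (at s)"
    note D = DERIV_mult[OF gradient_atD[where \<gamma>=\<gamma> and \<gamma>'=\<gamma>' and s=s, OF c \<gamma>(1) bspec[OF \<gamma>(2)]] gradient_atD[where \<gamma>=\<gamma> and \<gamma>'=\<gamma>' and s=s, OF d \<gamma>(1) bspec[OF \<gamma>(2)]]]
    have "(\<Sum>b\<in>B. c b * \<gamma>' b) * g P + (\<Sum>b\<in>B. d b * \<gamma>' b) * f P
        = (\<Sum>b\<in>B. (c b * g P + f P * d b) * \<gamma>' b)"
      by (simp add: algebra_simps sum_distrib_left sum.distrib)
    with D show "((\<lambda>s. f (\<gamma> s) * g (\<gamma> s)) has_field_derivative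
        (\<Sum>b\<in>B. (c b * g P + f P * d b) * \<gamma>' b)) (at s)"
      by (simp add: \<gamma>(1))
  qed
qed

section \<open>Local surjectivity of polynomial maps in a variable number of coordinates\<close>

definition coords :: "nat \<Rightarrow> ((nat \<Rightarrow> complex) \<Rightarrow> complex) set" where
  "coords N = (\<lambda>j t. t j) ` {..<N}"

lemma finite_coords [simp]: "finite (coords N)"
  by (simp add: coords_def)

lemma inj_coord: "inj_on (\<lambda>j t. t j :: complex) (A :: nat set)"
proof (rule inj_onI)
  fix i j :: nat assume eq: "(\<lambda>t. t i :: complex) = (\<lambda>t. t j)"
  show "i = j" using fun_cong[OF eq, of "\<lambda>k. if k = i then 1 else 0"] by (simp split: if_splits)
qed

text \<open>The Hadamard quotients are continuous and take the values \<open>d j\<close> at the pair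
  of origins, so the remainders \<open>R j\<close> become small nearby. This is strict
  differentiability at the origin.\<close>

lemma polyfun_coords_hadamard:
  assumes "f \<in> polyfun (coords N)"
    and D: "\<And>j. j < N \<Longrightarrow>
      ((\<lambda>s. f (\<lambda>i. if i = j then s else 0)) has_field_derivative d j) (at 0)"
  shows "\<exists>R. (\<forall>u v. f u - f v = (\<Sum>j<N. (u j - v j) * (d j + R j (u, v)))) \<and>
    (\<forall>\<epsilon>>0. \<exists>\<delta>>0. \<forall>u v. (\<forall>j<N. cmod (u j) < \<delta> \<and> cmod (v j) < \<delta>) \<longrightarrow>
      (\<forall>j<N. cmod (R j (u, v)) < \<epsilon>))"
proof -
  obtain Q where Q: "\<forall>b\<in>coords N. Q b \<in> polyfun (doubled (coords N))"
    and eq: "\<forall>u v. f u - f v = (\<Sum>b\<in>coords N. (b u - b v) * Q b (u, v))"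
    using polyfun_hadamard[OF assms(1)] by auto
  define q where "q = (\<lambda>j. Q (\<lambda>t. t j))"
  have q: "q j \<in> polyfun (doubled (coords N))" if "j < N" for j
    using Q that by (auto simp: q_def coords_def)
  have eq: "f u - f v = (\<Sum>j<N. (u j - v j) * q j (u, v))" for u v
    using eq[rule_format, of u v]
    by (simp add: coords_def sum.reindex[OF inj_coord] q_def)
  let ?o = "(\<lambda>_. 0, \<lambda>_. 0) :: (nat \<Rightarrow> complex) \<times> (nat \<Rightarrow> complex)"
  \<comment> \<open>On a pair consisting of a point of the \<open>j\<close>-th axis and the origin
    only the \<open>j\<close>-th summand survives, so \<open>q j\<close> is the ordinary difference
    quotient there.\<close>
  have q0: "q j ?o = d j" if j: "j < N" for j
  proof -
    define e where "e = (\<lambda>s i. if i = j then s else (0::complex))"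
    have "((\<lambda>s. (f (e s) - f (e 0)) / s) \<longlongrightarrow> d j) (at 0)"
      using D[OF j] by (simp add: has_field_derivative_iff e_def)
    moreover have "\<forall>\<^sub>F s in at 0. (f (e s) - f (e 0)) / s = q j (e s, e 0)"
      unfolding eventually_at_filter
    proof (rule always_eventually, intro allI impI)
      fix s :: complex assume s: "s \<noteq> 0"
      have "f (e s) - f (e 0) = (\<Sum>i<N. if i = j then s * q j (e s, e 0) else 0)"
        unfolding eq by (rule sum.cong) (auto simp: e_def)
      then show "(f (e s) - f (e 0)) / s = q j (e s, e 0)"
        using s j by simp
    qed
    ultimately have 1: "((\<lambda>s. q j (e s, e 0)) \<longlongrightarrow> d j) (at 0)"
      using tendsto_cong by fast
    have e0: "((\<lambda>s. e s i) \<longlongrightarrow> 0) (at 0)" for i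
      by (cases "i = j") (simp_all add: e_def tendsto_ident_at)
    have "(q j \<longlongrightarrow> q j ?o) (filtermap (\<lambda>s. (e s, e 0)) (at 0))"
    proof (rule polyfun_tendsto[OF q[OF j]])
      fix b assume "b \<in> doubled (coords N)"
      then consider i where "b = (\<lambda>w. fst w i)" | i where "b = (\<lambda>w. snd w i)"
        by (auto simp: doubled_def coords_def)
      then show "(b \<longlongrightarrow> b ?o) (filtermap (\<lambda>s. (e s, e 0)) (at 0))"
      proof cases
        case 1
        then show ?thesis unfolding filterlim_filtermap using e0 by simp
      next
        case 2
        then show ?thesis unfolding filterlim_filtermap by (simp add: e_def)
      qed
    qed
    then have "((\<lambda>s. q j (e s, e 0)) \<longlongrightarrow> q j ?o) (at 0)"
      by (simp add: filterlim_filtermap)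
    with 1 show ?thesis using tendsto_unique trivial_limit_at by blast
  qed
  show ?thesis
  proof (intro exI[of _ "\<lambda>j w. q j w - d j"] conjI allI impI)
    fix u v show "f u - f v = (\<Sum>j<N. (u j - v j) * (d j + (q j (u, v) - d j)))"
      using eq by simp
  next
    fix \<epsilon> :: real assume "\<epsilon> > 0"
    have "\<forall>j. \<exists>\<delta>>0. j < N \<longrightarrow> (\<forall>w. (\<forall>b\<in>doubled (coords N). cmod (b w - b ?o) < \<delta>) \<longrightarrow>
        cmod (q j w - q j ?o) < \<epsilon>)"
      using polyfun_bound[OF q \<open>\<epsilon> > 0\<close>, of _ ?o] by (metis zero_less_one)
    then obtain \<Delta> where \<Delta>: "\<And>j. \<Delta> j > 0" "\<And>j w. j < N \<Longrightarrow>
        (\<forall>b\<in>doubled (coords N). cmod (b w - b ?o) < \<Delta> j) \<Longrightarrow> cmod (q j w - q j ?o) < \<epsilon>"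
      by metis
    define \<delta> where "\<delta> = Min (insert 1 (\<Delta> ` {..<N}))"
    have \<delta>: "\<delta> > 0" "\<And>j. j < N \<Longrightarrow> \<delta> \<le> \<Delta> j"
      using \<Delta>(1) by (auto simp: \<delta>_def)
    show "\<exists>\<delta>>0. \<forall>u v. (\<forall>j<N. cmod (u j) < \<delta> \<and> cmod (v j) < \<delta>) \<longrightarrow>
      (\<forall>j<N. cmod (q j (u, v) - d j) < \<epsilon>)"
    proof (intro exI[of _ \<delta>] conjI allI impI)
      fix u v j assume uv: "\<forall>j<N. cmod (u j) < \<delta> \<and> cmod (v j) < \<delta>" and j: "j < N"
      have "\<forall>b\<in>doubled (coords N). cmod (b (u, v) - b ?o) < \<Delta> j"
        using uv \<delta>(2)[OF j] by (fastforce simp: doubled_def coords_def)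
      from \<Delta>(2)[OF j this] show "cmod (q j (u, v) - d j) < \<epsilon>" unfolding q0[OF j] .
    qed (fact \<delta>(1))
  qed
qed

text \<open>The number of coordinates is a variable here, so the inverse function theorem for Euclidean
  space types does not apply. The solution is the limit of the iteration \<open>u \<mapsto> u - \<Psi> u + r\<close>.\<close>

lemma polyfun_locally_surjective:
  fixes \<Psi> :: "nat \<Rightarrow> (nat \<Rightarrow> complex) \<Rightarrow> complex"
  assumes \<Psi>: "\<And>k. k < N \<Longrightarrow> \<Psi> k \<in> polyfun (coords N)"
    and D: "\<And>k j. k < N \<Longrightarrow> j < N \<Longrightarrow>
      ((\<lambda>s. \<Psi> k (\<lambda>i. if i = j then s else 0)) has_field_derivative (if k = j then 1 else 0)) (at 0)"
  shows "\<exists>\<epsilon>>0. \<forall>r. (\<forall>k<N. cmod (r k - \<Psi> k (\<lambda>_. 0)) < \<epsilon>) \<longrightarrow> (\<exists>u. \<forall>k<N. \<Psi> k u = r k)"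
proof (cases "N = 0")
  case True
  then show ?thesis by (auto intro: exI[of _ 1])
next
  case False
  \<comment> \<open>Summing the estimate over \<open>N\<close> components gives the factor
    \<open>N * \<eta> = 1 / 2\<close>, a contraction for the sum norm.\<close>
  define \<eta> where "\<eta> = 1 / (2 * real N)"
  have \<eta>: "\<eta> > 0" using False by (simp add: \<eta>_def)
  have "\<forall>k. \<exists>\<delta>>0. k < N \<longrightarrow> (\<forall>u v. (\<forall>j<N. cmod (u j) < \<delta> \<and> cmod (v j) < \<delta>) \<longrightarrow>
      cmod ((\<Psi> k u - \<Psi> k v) - (u k - v k)) \<le> \<eta> * (\<Sum>j<N. cmod (u j - v j)))"
  proof
    fix k
    show "\<exists>\<delta>>0. k < N \<longrightarrow> (\<forall>u v. (\<forall>j<N. cmod (u j) < \<delta> \<and> cmod (v j) < \<delta>) \<longrightarrow>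
      cmod ((\<Psi> k u - \<Psi> k v) - (u k - v k)) \<le> \<eta> * (\<Sum>j<N. cmod (u j - v j)))"
    proof (cases "k < N")
      case k: True
      obtain R where R: "\<forall>u v. \<Psi> k u - \<Psi> k v =
          (\<Sum>j<N. (u j - v j) * ((if k = j then 1 else 0) + R j (u, v)))"
        and b: "\<forall>\<epsilon>>0. \<exists>\<delta>>0. \<forall>u v. (\<forall>j<N. cmod (u j) < \<delta> \<and> cmod (v j) < \<delta>) \<longrightarrow>
          (\<forall>j<N. cmod (R j (u, v)) < \<epsilon>)"
        using polyfun_coords_hadamard[OF \<Psi>[OF k] D[OF k]] by blast
      obtain \<delta> where \<delta>: "\<delta> > 0" "\<forall>u v. (\<forall>j<N. cmod (u j) < \<delta> \<and> cmod (v j) < \<delta>) \<longrightarrow>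
          (\<forall>j<N. cmod (R j (u, v)) < \<eta>)"
        using b \<eta> by blast
      show ?thesis
      proof (intro exI[of _ \<delta>] conjI impI allI)
        fix u v assume "\<forall>j<N. cmod (u j) < \<delta> \<and> cmod (v j) < \<delta>"
        then have r: "cmod (R j (u, v)) < \<eta>" if "j < N" for j using \<delta>(2) that by blast
        have "\<Psi> k u - \<Psi> k v = (\<Sum>j<N. (if j = k then u k - v k else 0)
            + (u j - v j) * R j (u, v))"
          unfolding R[rule_format] by (rule sum.cong) (auto simp: algebra_simps)
        then have "\<Psi> k u - \<Psi> k v - (u k - v k) = (\<Sum>j<N. (u j - v j) * R j (u, v))"
          using k by (simp add: sum.distrib)
        also have "cmod \<dots> \<le> (\<Sum>j<N. cmod (u j - v j) * \<eta>)"
          by (rule sum_norm_le) (simp add: norm_mult mult_left_mono[OF less_imp_le[OF r]])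
        finally show "cmod ((\<Psi> k u - \<Psi> k v) - (u k - v k)) \<le> \<eta> * (\<Sum>j<N. cmod (u j - v j))"
          by (simp add: sum_distrib_left mult.commute)
      qed (use \<delta> in auto)
    qed (auto intro: exI[of _ 1])
  qed
  from choice[OF this] obtain \<Delta> where \<Delta>: "\<forall>k. \<Delta> k > 0 \<and> (k < N \<longrightarrow>
      (\<forall>u v. (\<forall>j<N. cmod (u j) < \<Delta> k \<and> cmod (v j) < \<Delta> k) \<longrightarrow>
      cmod ((\<Psi> k u - \<Psi> k v) - (u k - v k)) \<le> \<eta> * (\<Sum>j<N. cmod (u j - v j))))" ..
  define \<delta> where "\<delta> = Min (insert 1 (\<Delta> ` {..<N}))"
  have \<delta>: "\<delta> > 0" "\<And>j. j < N \<Longrightarrow> \<delta> \<le> \<Delta> j"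
    using \<Delta> by (auto simp: \<delta>_def)
  have contr: "cmod ((\<Psi> k u - \<Psi> k v) - (u k - v k)) \<le> \<eta> * (\<Sum>j<N. cmod (u j - v j))"
    if "k < N" "\<And>j. j < N \<Longrightarrow> cmod (u j) < \<delta>" "\<And>j. j < N \<Longrightarrow> cmod (v j) < \<delta>" for k u v
  proof -
    have "\<forall>j<N. cmod (u j) < \<Delta> k \<and> cmod (v j) < \<Delta> k"
      using that(2,3) \<delta>(2)[OF that(1)] by (meson order_less_le_trans)
    then show ?thesis using \<Delta>[rule_format, of k] that(1) by blast
  qed
  \<comment> \<open>Makes the first step of the iteration at most \<open>\<delta> / 4\<close> in the
    sum norm, so that all steps together have length at most \<open>\<delta> / 2\<close>.\<close>
  define \<epsilon> where "\<epsilon> = \<delta> / (4 * real N)"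
  show ?thesis
  proof (intro exI[of _ \<epsilon>] conjI allI impI)
    show "\<epsilon> > 0" using \<delta> False by (simp add: \<epsilon>_def)
    fix r :: "nat \<Rightarrow> complex" assume r: "\<forall>k<N. cmod (r k - \<Psi> k (\<lambda>_. 0)) < \<epsilon>"
    define U where "U = rec_nat (\<lambda>_. 0) (\<lambda>_ u k. u k - \<Psi> k u + r k)"
    have U: "U 0 = (\<lambda>_. 0)" "U (Suc n) = (\<lambda>k. U n k - \<Psi> k (U n) + r k)" for n
      by (simp_all add: U_def)
    define D where "D = (\<lambda>n. \<Sum>k<N. cmod (U (Suc n) k - U n k))"
    have comp: "cmod (U (Suc n) k - U n k) \<le> D n" if "k < N" for k n
      unfolding D_def by (rule member_le_sum) (use that in auto)
    have D0: "D 0 \<le> \<delta> / 4"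
    proof -
      have "D 0 \<le> (\<Sum>k<N. \<epsilon>)" unfolding D_def
        by (rule sum_mono) (use r in \<open>auto simp: U norm_minus_commute less_imp_le\<close>)
      then show ?thesis using False by (simp add: \<epsilon>_def)
    qed
    \<comment> \<open>The second bound is the geometric sum of the first one. It keeps the iterates
      in the region where \<open>contr\<close> applies, so both have to be proved together.\<close>
    have main: "D n \<le> \<delta> / 4 / 2 ^ n \<and> (\<forall>k<N. cmod (U n k) \<le> \<delta> / 2 * (1 - 1 / 2 ^ n))" for n
    proof (induction n)
      case 0
      then show ?case using D0 by (simp add: U)
    next
      case (Suc n)
      have small: "cmod (U (Suc n) k) \<le> \<delta> / 2 * (1 - 1 / 2 ^ Suc n)" if k: "k < N" for k
      proof -
        have "cmod (U (Suc n) k) \<le> cmod (U n k) + cmod (U (Suc n) k - U n k)"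
          by (metis add.commute diff_add_cancel norm_triangle_ineq)
        also have "\<dots> \<le> \<delta> / 2 * (1 - 1 / 2 ^ n) + \<delta> / 4 / 2 ^ n"
          using comp[OF k, of n] Suc k by (intro add_mono) force+
        also have "\<dots> = \<delta> / 2 * (1 - 1 / 2 ^ Suc n)" by (simp add: field_simps)
        finally show ?thesis .
      qed
      have lt: "\<delta> / 2 * (1 - 1 / 2 ^ n) < \<delta>" for n :: nat
      proof -
        have "\<delta> / 2 * (1 - 1 / 2 ^ n) \<le> \<delta> / 2 * 1"
          using \<delta> by (intro mult_left_mono) auto
        then show ?thesis using \<delta>(1) by linarith
      qed
      have "cmod (U (Suc (Suc n)) k - U (Suc n) k) \<le> \<eta> * D n" if k: "k < N" for k
      proof -
        have "U (Suc (Suc n)) k - U (Suc n) k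
            = - ((\<Psi> k (U (Suc n)) - \<Psi> k (U n)) - (U (Suc n) k - U n k))"
          by (subst U(2)[of "Suc n"], subst (2) U(2)[of n]) (simp add: U(2))
        then have "cmod (U (Suc (Suc n)) k - U (Suc n) k)
            = cmod ((\<Psi> k (U (Suc n)) - \<Psi> k (U n)) - (U (Suc n) k - U n k))"
          by (metis norm_minus_cancel)
        also have "\<dots> \<le> \<eta> * D n" unfolding D_def
          by (rule contr[OF k]) (use small Suc lt order_le_less_trans in blast)+
        finally show ?thesis .
      qed
      then have "(\<Sum>k<N. cmod (U (Suc (Suc n)) k - U (Suc n) k)) \<le> (\<Sum>k<N. \<eta> * D n)"
        by (intro sum_mono) auto
      then have "D (Suc n) \<le> (\<Sum>k<N. \<eta> * D n)" by (simp only: D_def)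
      also have "\<dots> = D n / 2" using False by (simp add: \<eta>_def)
      also have "\<dots> \<le> \<delta> / 4 / 2 ^ Suc n" using Suc by simp
      finally show ?case using small by blast
    qed
    have U\<delta>: "cmod (U n k) \<le> \<delta> / 2" if "k < N" for n k
    proof -
      have "\<delta> / 2 * (1 - 1 / 2 ^ n) \<le> \<delta> / 2 * 1"
        using \<delta> by (intro mult_left_mono) auto
      then show ?thesis using main[of n] that by force
    qed
    have "convergent (\<lambda>n. U n k)" if k: "k < N" for k
    proof -
      have "summable (\<lambda>n. U (Suc n) k - U n k)"
      proof (rule summable_comparison_test')
        show "summable (\<lambda>n. \<delta> / 4 * (1 / 2) ^ n)"
          by (intro summable_mult summable_geometric) auto
        show "norm (U (Suc n) k - U n k) \<le> \<delta> / 4 * (1 / 2) ^ n" if "n \<ge> 0" for n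
          using comp[OF k, of n] main[of n] by (simp add: power_one_over)
      qed
      moreover have "(\<lambda>m. \<Sum>n<m. U (Suc n) k - U n k) = (\<lambda>m. U m k)"
        using sum_lessThan_telescope[of "\<lambda>n. U n k"] U(1) by simp
      ultimately show ?thesis unfolding summable_iff_convergent by simp
    qed
    then obtain u where u: "\<And>k. k < N \<Longrightarrow> (\<lambda>n. U n k) \<longlonglongrightarrow> u k"
      unfolding convergent_def by metis
    have u\<delta>: "cmod (u k) < \<delta>" if "k < N" for k
    proof -
      have "cmod (u k) \<le> \<delta> / 2"
        by (rule LIMSEQ_le_const2[OF tendsto_norm[OF u[OF that]]]) (use U\<delta> that in auto)
      then show ?thesis using \<delta>(1) by linarith
    qed
    show "\<exists>u. \<forall>k<N. \<Psi> k u = r k"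
    proof (intro exI[of _ u] allI impI)
      fix k assume k: "k < N"
      have "(\<lambda>n. (\<Sum>j<N. cmod (U n j - u j))) \<longlonglongrightarrow> (\<Sum>j<N. cmod (u j - u j))"
        by (intro tendsto_intros u) auto
      then have z: "(\<lambda>n. \<eta> * (\<Sum>j<N. cmod (U n j - u j))) \<longlonglongrightarrow> 0"
        using tendsto_mult_right_zero by auto
      have lt: "cmod (U n j) < \<delta>" if "j < N" for n j using U\<delta>[OF that, of n] \<delta>(1) by linarith
      \<comment> \<open>Continuity of \<open>\<Psi> k\<close> at the limit is read off from
        \<open>contr\<close>, applied to \<open>U n\<close> and \<open>u\<close>.\<close>
      have "(\<lambda>n. (\<Psi> k (U n) - \<Psi> k u) - (U n k - u k)) \<longlonglongrightarrow> 0"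
        by (rule Lim_null_comparison[OF always_eventually z]) (use contr[OF k] lt u\<delta> in blast)
      then have "(\<lambda>n. ((\<Psi> k (U n) - \<Psi> k u) - (U n k - u k)) + (U n k - u k)) \<longlonglongrightarrow> 0 + (u k - u k)"
        by (intro tendsto_intros u k)
      then have 1: "(\<lambda>n. \<Psi> k (U n)) \<longlonglongrightarrow> \<Psi> k u" by (simp add: LIM_zero_iff)
      have "(\<lambda>n. U (Suc n) k) \<longlonglongrightarrow> u k - \<Psi> k u + r k"
        unfolding U by (intro tendsto_intros 1 u k)
      moreover have "(\<lambda>n. U (Suc n) k) \<longlonglongrightarrow> u k" using u[OF k] LIMSEQ_Suc by blast
      ultimately have "u k - \<Psi> k u + r k = u k" by (rule LIMSEQ_unique)
      then show "\<Psi> k u = r k" by (metis add.commute add_diff_cancel_left' diff_add_eq diff_diff_eq2)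
    qed
  qed
qed

subsection \<open>The flows and the group they generate\<close>

lemma higher_pderiv_shift:
  "(pderiv ^^ k) (pcompose p [:z, 1:]) = pcompose ((pderiv ^^ k) p) [:z, 1:]"
  for p :: "'a :: field_char_0 poly"
  by (induction k) (simp_all add: pderiv_pcompose pderiv_pCons)

lemma poly_taylor:
  fixes p :: "complex poly"
  shows "poly p (z + w) = (\<Sum>k\<le>degree p. w ^ k * poly ((pderiv ^^ k) p) z / fact k)"
proof -
  have "poly p (z + w) = poly (pcompose p [:z, 1:]) w" by (simp add: poly_pcompose)
  also have "\<dots> = (\<Sum>k\<le>degree p. coeff (pcompose p [:z, 1:]) k * w ^ k)"
    by (simp add: poly_altdef degree_pcompose)
  also have "\<dots> = (\<Sum>k\<le>degree p. w ^ k * poly ((pderiv ^^ k) p) z / fact k)"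
  proof (rule sum.cong)
    fix k
    have "poly ((pderiv ^^ k) p) z = coeff ((pderiv ^^ k) (pcompose p [:z, 1:])) 0"
      by (simp add: higher_pderiv_shift poly_pcompose flip: poly_0_coeff_0)
    also have "\<dots> = fact k * coeff (pcompose p [:z, 1:]) k"
      by (simp add: coeff_higher_pderiv pochhammer_fact)
    finally show "coeff (pcompose p [:z, 1:]) k * w ^ k = w ^ k * poly ((pderiv ^^ k) p) z / fact k"
      by simp
  qed simp
  finally show ?thesis .
qed

text \<open>The quotient \<open>(p (z + t y) - p z) / y\<close> with the division carried out, so that it also has
  the right value at \<open>y = 0\<close>.\<close>

definition diff_quot :: "complex poly \<Rightarrow> complex \<Rightarrow> complex \<Rightarrow> complex \<Rightarrow> complex" where
  "diff_quot p t y z = (\<Sum>k=1..degree p. inverse (fact k) * t ^ k * y ^ (k - 1) * poly ((pderiv ^^ k) p) z)"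

lemma diff_quot_mult: "y * diff_quot p t y z = poly p (z + t * y) - poly p z"
proof -
  have "y * diff_quot p t y z = (\<Sum>k=1..degree p. (t * y) ^ k * poly ((pderiv ^^ k) p) z / fact k)"
    unfolding diff_quot_def sum_distrib_left
  proof (rule sum.cong)
    fix k assume "k \<in> {1..degree p}"
    then have "y ^ k = y * y ^ (k - 1)" by (simp add: power_eq_if)
    then show "y * (inverse (fact k) * t ^ k * y ^ (k - 1) * poly ((pderiv ^^ k) p) z)
        = (t * y) ^ k * poly ((pderiv ^^ k) p) z / fact k"
      by (simp add: power_mult_distrib field_simps)
  qed simp
  moreover have "{..degree p} = insert 0 {1..degree p}" by auto
  ultimately show ?thesis by (simp add: poly_taylor[of p z "t * y"])
qed

lemma diff_quot_0: "diff_quot p t 0 z = t * poly (pderiv p) z"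
proof (cases "degree p = 0")
  case True
  then have "pderiv p = 0" by (simp add: pderiv_eq_0_iff)
  then show ?thesis using True by (simp add: diff_quot_def)
next
  case False
  have "diff_quot p t 0 z = (\<Sum>k=1..degree p. if k = 1 then t * poly (pderiv p) z else 0)"
    unfolding diff_quot_def by (rule sum.cong) auto
  then show ?thesis using False by simp
qed

lemma diff_quot_eq: "y \<noteq> 0 \<Longrightarrow> diff_quot p t y z = (poly p (z + t * y) - poly p z) / y"
  using diff_quot_mult[of y p t z] by (simp add: field_simps)

text \<open>The cocycle identity behind the group law of the flow: the second step starts at the
  shifted point \<open>z + s * y\<close>.\<close>

lemma diff_quot_add: "diff_quot p s y z + diff_quot p t y (z + s * y) = diff_quot p (s + t) y z"
  by (cases "y = 0") (simp_all add: diff_quot_0 diff_quot_eq field_simps)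

lemma diff_quot_zero [simp]: "diff_quot p 0 y z = 0"
  by (cases "y = 0") (simp_all add: diff_quot_0 diff_quot_eq)

lemma polyfun_diff_quot:
  assumes "t \<in> polyfun B" "y \<in> polyfun B" "z \<in> polyfun B"
  shows "(\<lambda>u. diff_quot p (t u) (y u) (z u)) \<in> polyfun B"
  unfolding diff_quot_def
  by (intro polyfun_sum polyfun.mult polyfun_power polyfun_poly polyfun.const assms)

text \<open>The time 1 map of \<open>(a + b y) V\<close> on the whole ambient space.\<close>

definition vflow :: "complex poly \<Rightarrow> complex \<Rightarrow> complex \<Rightarrow> C3 \<Rightarrow> C3" where
  "vflow p a b = (\<lambda>(x, y, z). (x + diff_quot p (a + b * y) y z, y, z + (a + b * y) * y))"

text \<open>This symmetry of \<open>x y = p z\<close> exchanges \<open>V\<close> with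
  \<open>W\<close> and \<open>y V\<close> with \<open>x W\<close>; all facts about \<open>W\<close>
  are transported along it.\<close>

definition swap :: "C3 \<Rightarrow> C3" where
  "swap = (\<lambda>(x, y, z). (y, x, z))"

definition wflow :: "complex poly \<Rightarrow> complex \<Rightarrow> complex \<Rightarrow> C3 \<Rightarrow> C3" where
  "wflow p a b q = swap (vflow p a b (swap q))"

lemma swap_swap [simp]: "swap (swap q) = q"
  by (cases q) (simp add: swap_def)

lemma vflow_simp: "vflow p a b (x, y, z) = (x + diff_quot p (a + b * y) y z, y, z + (a + b * y) * y)"
  by (simp add: vflow_def)

text \<open>The coordinate \<open>y\<close> is constant along the flow, so \<open>a + b * y\<close>
  acts as a fixed time and times add. In particular \<open>V\<close> and \<open>y V\<close>
  commute.\<close>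

lemma vflow_vflow: "vflow p a b (vflow p c d q) = vflow p (a + c) (b + d) q"
proof (cases q)
  case (fields x y z)
  have "diff_quot p (c + d * y) y z + diff_quot p (a + b * y) y (z + (c + d * y) * y)
      = diff_quot p (a + c + (b + d) * y) y z"
    unfolding diff_quot_add by (simp add: algebra_simps)
  then show ?thesis by (simp add: fields vflow_simp algebra_simps)
qed

lemma vflow_0 [simp]: "vflow p 0 0 q = q"
  by (cases q) (simp add: vflow_simp)

lemma wflow_0 [simp]: "wflow p 0 0 q = q"
  by (simp add: wflow_def)

lemma wflow_wflow: "wflow p a b (wflow p c d q) = wflow p (a + c) (b + d) q"
  by (simp add: wflow_def vflow_vflow)

lemma swap_Zp [simp]: "swap q \<in> Zp p \<longleftrightarrow> q \<in> Zp p"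
  by (cases q) (auto simp: swap_def Zp_def mult.commute)

lemma vflow_Zp: "q \<in> Zp p \<Longrightarrow> vflow p a b q \<in> Zp p"
  by (cases q) (auto simp: vflow_simp Zp_def algebra_simps diff_quot_mult)

lemma wflow_Zp: "q \<in> Zp p \<Longrightarrow> wflow p a b q \<in> Zp p"
  by (simp add: wflow_def vflow_Zp)

text \<open>On functions of \<open>y\<close> and \<open>z\<close> the derivation
  \<open>y ^ e V\<close> is \<open>y ^ (e + 1)\<close> times differentiation in \<open>z\<close>, so
  the exponential series of \<open>x\<close> is a Taylor expansion of \<open>p\<close> and
  terminates. The exponents 0 and 1 give \<open>V\<close> and \<open>y V\<close>.\<close>

lemma flow_map_V:
  assumes e: "(\<And>q. h q = crd_y q ^ e)"
  shows "flow_map (scale_der h (V_der p)) t (x, y, z) = (x + diff_quot p (t * y ^ e) y z, y, z + t * y ^ e * y)"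
proof -
  define \<Theta> where "\<Theta> = scale_der h (V_der p)"
  have step: "\<Theta> (\<lambda>q. crd_y q ^ m * poly r (crd_z q))
      = (\<lambda>q. crd_y q ^ (m + e + 1) * poly (pderiv r) (crd_z q))" for m r
  proof
    fix q :: C3 obtain x y z where q: "q = (x, y, z)" by (cases q)
    have "((\<lambda>s. y ^ m * poly r s) has_field_derivative y ^ m * poly (pderiv r) z) (at z)"
      by (intro DERIV_cmult poly_DERIV)
    then have "deriv (\<lambda>s. y ^ m * poly r s) z = y ^ m * poly (pderiv r) z" by (rule DERIV_imp_deriv)
    then show "\<Theta> (\<lambda>q. crd_y q ^ m * poly r (crd_z q)) q
      = crd_y q ^ (m + e + 1) * poly (pderiv r) (crd_z q)"
      by (simp add: \<Theta>_def scale_der_def V_der_def e q d_x_def d_z_def power_add)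
  qed
  have x1: "\<Theta> crd_x = (\<lambda>q. crd_y q ^ e * poly (pderiv p) (crd_z q))"
    by (auto simp: \<Theta>_def scale_der_def V_der_def e d_x_def d_z_def fun_eq_iff)
  \<comment> \<open>The exponent equals \<open>(k + 1) * (e + 1) - 1\<close>. The one missing factor
    \<open>y\<close> is the division by \<open>y\<close> in \<open>diff_quot\<close>.\<close>
  have xk: "(\<Theta> ^^ Suc k) crd_x
      = (\<lambda>q. crd_y q ^ (e + k * (e + 1)) * poly ((pderiv ^^ Suc k) p) (crd_z q))" for k
  proof (induction k)
    case (Suc k)
    have "(\<Theta> ^^ Suc (Suc k)) crd_x = \<Theta> ((\<Theta> ^^ Suc k) crd_x)" by simp
    also have "\<dots> = (\<lambda>q. crd_y q ^ (e + k * (e + 1) + e + 1)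
        * poly (pderiv ((pderiv ^^ Suc k) p)) (crd_z q))"
      unfolding Suc.IH step ..
    finally show ?case by (simp add: algebra_simps)
  qed (simp add: x1)
  have "exp_der t \<Theta> crd_x (x, y, z) = (\<Sum>k\<le>degree p. t ^ k / fact k * (\<Theta> ^^ k) crd_x (x, y, z))"
    unfolding exp_der_def
  proof (rule suminf_finite)
    fix k assume "k \<notin> {..degree p}"
    then obtain j where j: "k = Suc j" "j \<ge> degree p"
      by (metis atMost_iff not_less_eq_eq not0_implies_Suc le0)
    then have "degree ((pderiv ^^ j) p) = 0" by (simp add: degree_higher_pderiv)
    then have "(pderiv ^^ k) p = 0" using j by (simp add: pderiv_eq_0_iff)
    then show "t ^ k / fact k * (\<Theta> ^^ k) crd_x (x, y, z) = 0"
      unfolding j(1) xk by simp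
  qed simp
  also have "{..degree p} = insert 0 {1..degree p}" by auto
  also have "(\<Sum>k\<in>insert 0 {1..degree p}. t ^ k / fact k * (\<Theta> ^^ k) crd_x (x, y, z))
      = x + (\<Sum>k=1..degree p. t ^ k / fact k * (\<Theta> ^^ k) crd_x (x, y, z))"
    by (subst sum.insert) auto
  also have "(\<Sum>k=1..degree p. t ^ k / fact k * (\<Theta> ^^ k) crd_x (x, y, z)) = diff_quot p (t * y ^ e) y z"
    unfolding diff_quot_def
  proof (rule sum.cong)
    fix k assume "k \<in> {1..degree p}"
    then obtain j where j: "k = Suc j" by (cases k) auto
    have "y ^ (e + j * (e + 1)) = (y ^ e) ^ k * y ^ (k - 1)"
      by (simp add: j algebra_simps flip: power_mult power_add)
    then show "t ^ k / fact k * (\<Theta> ^^ k) crd_x (x, y, z)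
        = inverse (fact k) * (t * y ^ e) ^ k * y ^ (k - 1) * poly ((pderiv ^^ k) p) z"
      unfolding j xk by (simp add: power_mult_distrib divide_inverse mult_ac del: power_Suc)
  qed simp
  finally have X: "exp_der t \<Theta> crd_x (x, y, z) = x + diff_quot p (t * y ^ e) y z" .
  have \<Theta>0: "\<Theta> (\<lambda>_. 0) = (\<lambda>_. 0)"
    by (simp add: \<Theta>_def scale_der_def V_der_def d_x_def d_z_def fun_eq_iff)
  have "\<Theta> crd_y = (\<lambda>_. 0)"
    by (simp add: \<Theta>_def scale_der_def V_der_def d_x_def d_z_def fun_eq_iff)
  with \<Theta>0 have Y: "exp_der t \<Theta> crd_y (x, y, z) = y" by (subst exp_der_quadratic) auto
  have z1: "\<Theta> crd_z = (\<lambda>q. crd_y q ^ e * crd_y q)"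
    by (simp add: \<Theta>_def scale_der_def V_der_def e d_x_def d_z_def fun_eq_iff)
  have "\<Theta> (\<Theta> crd_z) = (\<lambda>_. 0)" unfolding z1
    by (simp add: \<Theta>_def scale_der_def V_der_def d_x_def d_z_def fun_eq_iff)
  with \<Theta>0 have Z: "exp_der t \<Theta> crd_z (x, y, z) = z + t * y ^ e * y"
    by (subst exp_der_quadratic) (auto simp: z1)
  show ?thesis unfolding flow_map_def \<Theta>_def[symmetric] X Y Z ..
qed

lemma flow_map_vflow:
  "flow_map (V_der p) t = vflow p t 0"
  "flow_map (scale_der crd_y (V_der p)) t = vflow p 0 t"
proof -
  have "scale_der (\<lambda>_. 1) (V_der p) = V_der p" by (simp add: scale_der_def fun_eq_iff)
  then show "flow_map (V_der p) t = vflow p t 0"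
    using flow_map_V[of "\<lambda>_. 1" 0 p t] by (force simp: vflow_simp)
  show "flow_map (scale_der crd_y (V_der p)) t = vflow p 0 t"
    using flow_map_V[of crd_y 1 p t] by (auto simp: fun_eq_iff vflow_simp)
qed

lemma flow_map_swap:
  assumes "\<And>f. \<Theta>' f = (\<lambda>q. \<Theta> (\<lambda>u. f (swap u)) (swap q))"
  shows "flow_map \<Theta>' t q = swap (flow_map \<Theta> t (swap q))"
proof -
  have pow: "(\<Theta>' ^^ k) f = (\<lambda>q. (\<Theta> ^^ k) (\<lambda>u. f (swap u)) (swap q))" for k f
  proof (induction k)
    case (Suc k)
    have "(\<Theta>' ^^ Suc k) f = \<Theta>' ((\<Theta>' ^^ k) f)" by simp
    also have "\<dots> = (\<lambda>q. (\<Theta> ^^ Suc k) (\<lambda>u. f (swap u)) (swap q))"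
      unfolding Suc.IH assms by simp
    finally show ?case .
  qed simp
  have e: "exp_der t \<Theta>' f q = exp_der t \<Theta> (\<lambda>u. f (swap u)) (swap q)" for f
    by (simp add: exp_der_def pow)
  have "(\<lambda>u. crd_x (swap u)) = crd_y" "(\<lambda>u. crd_y (swap u)) = crd_x" "(\<lambda>u. crd_z (swap u)) = crd_z"
    by (auto simp: swap_def fun_eq_iff)
  then show ?thesis unfolding flow_map_def e by (simp add: swap_def)
qed

lemma flow_map_wflow:
  "flow_map (W_der p) t = wflow p t 0"
  "flow_map (scale_der crd_x (W_der p)) t = wflow p 0 t"
proof -
  have 1: "W_der p f = (\<lambda>q. V_der p (\<lambda>u. f (swap u)) (swap q))" for f
    by (auto simp: W_der_def V_der_def swap_def d_x_def d_y_def d_z_def fun_eq_iff)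
  then have 2: "scale_der crd_x (W_der p) f = (\<lambda>q. scale_der crd_y (V_der p) (\<lambda>u. f (swap u)) (swap q))" for f
    by (auto simp: scale_der_def swap_def fun_eq_iff)
  show "flow_map (W_der p) t = wflow p t 0"
    using flow_map_swap[of "W_der p" "V_der p", OF 1] by (simp add: fun_eq_iff wflow_def flow_map_vflow)
  show "flow_map (scale_der crd_x (W_der p)) t = wflow p 0 t"
    using flow_map_swap[of "scale_der crd_x (W_der p)" "scale_der crd_y (V_der p)", OF 2] by (simp add: fun_eq_iff wflow_def flow_map_vflow)
qed

text \<open>Words in the flows, kept as maps of the whole ambient space because partial derivatives
  and the bracket live there; restriction to \<open>Zp p\<close> is postponed to the link with
  \<open>flow_group\<close>. Inverses come for free by negating parameters.\<close>

inductive_set moves :: "complex poly \<Rightarrow> (C3 \<Rightarrow> C3) set" for p where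
  ident: "(\<lambda>q. q) \<in> moves p"
| vflow: "g \<in> moves p \<Longrightarrow> (\<lambda>q. vflow p a b (g q)) \<in> moves p"
| wflow: "g \<in> moves p \<Longrightarrow> (\<lambda>q. wflow p a b (g q)) \<in> moves p"

lemma moves_comp:
  assumes "g \<in> moves p" "h \<in> moves p" shows "(\<lambda>q. g (h q)) \<in> moves p"
  using assms by (induction rule: moves.induct) (auto intro: moves.intros)

lemma vflow_moves: "vflow p a b \<in> moves p" and wflow_moves: "wflow p a b \<in> moves p"
  using moves.vflow[OF moves.ident] moves.wflow[OF moves.ident] by simp_all

lemma moves_inverse:
  assumes "g \<in> moves p"
  obtains h where "h \<in> moves p" "\<And>q. h (g q) = q" "\<And>q. g (h q) = q"
proof -
  have "\<exists>h\<in>moves p. (\<forall>q. h (g q) = q) \<and> (\<forall>q. g (h q) = q)"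
    using assms
  proof (induction rule: moves.induct)
    case ident
    show ?case by (rule bexI[OF _ moves.ident]) auto
  next
    case (vflow g a b)
    then obtain h where h: "h \<in> moves p" "\<forall>q. h (g q) = q" "\<forall>q. g (h q) = q" by blast
    show ?case
      by (rule bexI[OF _ moves_comp[OF h(1) vflow_moves[of p "-a" "-b"]]])
        (simp add: h vflow_vflow)
  next
    case (wflow g a b)
    then obtain h where h: "h \<in> moves p" "\<forall>q. h (g q) = q" "\<forall>q. g (h q) = q" by blast
    show ?case
      by (rule bexI[OF _ moves_comp[OF h(1) wflow_moves[of p "-a" "-b"]]])
        (simp add: h wflow_wflow)
  qed
  then show ?thesis using that by blast
qed

lemma moves_Zp:
  assumes "g \<in> moves p" "q \<in> Zp p" shows "g q \<in> Zp p"
  using assms by (induction rule: moves.induct) (auto intro: vflow_Zp wflow_Zp)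

lemma moves_Bij:
  assumes "g \<in> moves p" shows "restrict g (Zp p) \<in> Bij (Zp p)"
proof -
  obtain h where h: "h \<in> moves p" "\<And>q. h (g q) = q" "\<And>q. g (h q) = q"
    using moves_inverse[OF assms] by blast
  have "bij_betw g (Zp p) (Zp p)"
    by (rule bij_betw_byWitness[where f' = h]) (auto simp: h moves_Zp assms)
  then show ?thesis by (auto simp: Bij_def bij_betw_restrict_eq)
qed

lemma moves_flow_group_comp:
  assumes "g \<in> moves p" "restrict g (Zp p) \<in> flow_group p"
    and "h \<in> moves p" "restrict h (Zp p) \<in> flow_group p"
  shows "restrict (\<lambda>q. g (h q)) (Zp p) \<in> flow_group p"
proof -
  have "restrict g (Zp p) \<otimes>\<^bsub>BijGroup (Zp p)\<^esub> restrict h (Zp p)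
      = compose (Zp p) (restrict g (Zp p)) (restrict h (Zp p))"
    using moves_Bij assms by (simp add: BijGroup_def)
  also have "\<dots> = restrict (\<lambda>q. g (h q)) (Zp p)"
    using moves_Zp[OF assms(3)] by (auto simp: compose_def restrict_def)
  finally show ?thesis using assms(2,4) generate.eng unfolding flow_group_def by metis
qed

lemma moves_flow_group:
  assumes "g \<in> moves p" shows "restrict g (Zp p) \<in> flow_group p"
proof -
  have gen: "restrict (flow_map \<Theta> t) (Zp p) \<in> flow_group p" if "\<Theta> \<in> four_derivations p" for \<Theta> t
    unfolding flow_group_def
    by (rule generate.incl) (use that in \<open>auto simp: unipotent_group_def\<close>)
  \<comment> \<open>The generators offer \<open>V\<close> and \<open>y V\<close> separately; the
    two-parameter flow is their composite by \<open>vflow_vflow\<close>.\<close>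
  have v: "restrict (vflow p a b) (Zp p) \<in> flow_group p" for a b
  proof -
    have "restrict (vflow p a 0) (Zp p) \<in> flow_group p" "restrict (vflow p 0 b) (Zp p) \<in> flow_group p"
      using gen[of "V_der p" a] gen[of "scale_der crd_y (V_der p)" b]
      by (simp_all add: four_derivations_def flow_map_vflow)
    from moves_flow_group_comp[OF vflow_moves this(1) vflow_moves this(2)]
    show ?thesis by (simp add: vflow_vflow)
  qed
  have w: "restrict (wflow p a b) (Zp p) \<in> flow_group p" for a b
  proof -
    have "restrict (wflow p a 0) (Zp p) \<in> flow_group p" "restrict (wflow p 0 b) (Zp p) \<in> flow_group p"
      using gen[of "W_der p" a] gen[of "scale_der crd_x (W_der p)" b]
      by (simp_all add: four_derivations_def flow_map_wflow)
    from moves_flow_group_comp[OF wflow_moves this(1) wflow_moves this(2)]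
    show ?thesis by (simp add: wflow_wflow)
  qed
  show ?thesis using assms
  proof (induction rule: moves.induct)
    case ident
    have "restrict (\<lambda>q. q) (Zp p) = \<one>\<^bsub>BijGroup (Zp p)\<^esub>" by (simp add: BijGroup_def)
    then show ?case unfolding flow_group_def by (metis generate.one)
  next
    case (vflow g a b)
    then show ?case using moves_flow_group_comp[OF vflow_moves v] by blast
  next
    case (wflow g a b)
    then show ?case using moves_flow_group_comp[OF wflow_moves w] by blast
  qed
qed

section \<open>Chain rule in the ambient coordinates\<close>

definition xyz :: "(C3 \<Rightarrow> complex) set" where
  "xyz = {crd_x, crd_y, crd_z}"

lemma crd_distinct: "crd_x \<noteq> crd_y" "crd_x \<noteq> crd_z" "crd_y \<noteq> crd_z"
proof -
  have "crd_x (1, 0, 0) \<noteq> crd_y (1, 0, 0)" "crd_x (1, 0, 0) \<noteq> crd_z (1, 0, 0)"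
    "crd_y (0, 1, 0) \<noteq> crd_z (0, 1, 0)" by simp_all
  then show "crd_x \<noteq> crd_y" "crd_x \<noteq> crd_z" "crd_y \<noteq> crd_z" by metis+
qed

lemma polyfun_crd: "crd_x \<in> polyfun xyz" "crd_y \<in> polyfun xyz" "crd_z \<in> polyfun xyz"
  by (auto simp: xyz_def intro: polyfun.base)

text \<open>The partial derivative operators see one variable at a time. Polynomiality supplies a
  full gradient, and its entries are identified with the partials by running along the three
  coordinate lines.\<close>

lemma polyfun_xyz_chain:
  assumes "f \<in> polyfun xyz"
    and "(X has_field_derivative x') (at s)" "(Y has_field_derivative y') (at s)"
      "(Z has_field_derivative z') (at s)"
  defines "P \<equiv> (X s, Y s, Z s)"
  shows "((\<lambda>s. f (X s, Y s, Z s)) has_field_derivative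
    d_x f P * x' + d_y f P * y' + d_z f P * z') (at s)"
proof -
  obtain c where c: "gradient_at xyz P c f"
    using polyfun_gradient[OF assms(1), of P] by (auto simp: xyz_def)
  have D: "((\<lambda>s. f (X s, Y s, Z s)) has_field_derivative
      c crd_x * x' + c crd_y * y' + c crd_z * z') (at s)"
    if "P = (X s, Y s, Z s)" "(X has_field_derivative x') (at s)"
      "(Y has_field_derivative y') (at s)" "(Z has_field_derivative z') (at s)" for X Y Z x' y' z' s
  proof -
    define \<gamma>' where "\<gamma>' b = (if b = crd_x then x' else if b = crd_y then y' else z')" for b
    have "((\<lambda>s. f (X s, Y s, Z s)) has_field_derivative (\<Sum>b\<in>xyz. c b * \<gamma>' b)) (at s)"
      by (rule gradient_atD[OF c, where \<gamma> = "\<lambda>s. (X s, Y s, Z s)"])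
        (use that crd_distinct in \<open>auto simp: xyz_def \<gamma>'_def\<close>)
    moreover have "(\<Sum>b\<in>xyz. c b * \<gamma>' b) = c crd_x * x' + c crd_y * y' + c crd_z * z'"
      using crd_distinct by (simp add: xyz_def \<gamma>'_def add.assoc)
    ultimately show ?thesis by simp
  qed
  have "d_x f P = c crd_x"
    using D[OF _ DERIV_ident DERIV_const DERIV_const, of "X s" "Y s" "Z s"]
    by (simp add: d_x_def P_def DERIV_imp_deriv)
  moreover have "d_y f P = c crd_y"
    using D[OF _ DERIV_const DERIV_ident DERIV_const, of "X s" "Y s" "Z s"]
    by (simp add: d_y_def P_def DERIV_imp_deriv)
  moreover have "d_z f P = c crd_z"
    using D[OF _ DERIV_const DERIV_const DERIV_ident, of "X s" "Y s" "Z s"]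
    by (simp add: d_z_def P_def DERIV_imp_deriv)
  ultimately show ?thesis using D[OF _ assms(2-4)] by (simp add: P_def)
qed

subsection \<open>The Poisson bracket and Hamiltonian functions of the group\<close>

lemma polyfun_partials:
  assumes "f \<in> polyfun xyz"
  shows "((\<lambda>s. f (s, y, z)) has_field_derivative d_x f (x, y, z)) (at x)"
    "((\<lambda>s. f (x, s, z)) has_field_derivative d_y f (x, y, z)) (at y)"
    "((\<lambda>s. f (x, y, s)) has_field_derivative d_z f (x, y, z)) (at z)"
  using polyfun_xyz_chain[where X = "\<lambda>s. s" and Y = "\<lambda>_. y" and Z = "\<lambda>_. z" and s = x,
      OF assms DERIV_ident DERIV_const DERIV_const]
    polyfun_xyz_chain[where X = "\<lambda>_. x" and Y = "\<lambda>s. s" and Z = "\<lambda>_. z" and s = y,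
      OF assms DERIV_const DERIV_ident DERIV_const]
    polyfun_xyz_chain[where X = "\<lambda>_. x" and Y = "\<lambda>_. y" and Z = "\<lambda>s. s" and s = z,
      OF assms DERIV_const DERIV_const DERIV_ident]
  by simp_all

text \<open>The bracket with Casimir function \<open>x y - p z\<close>, normalised such that \<open>{y, \<cdot>} = V\<close> and
  \<open>{x, \<cdot>} = - W\<close>.\<close>

definition poisson :: "complex poly \<Rightarrow> (C3 \<Rightarrow> complex) \<Rightarrow> (C3 \<Rightarrow> complex) \<Rightarrow> C3 \<Rightarrow> complex" where
  "poisson p f g q =
     (d_y f q * d_x g q - d_x f q * d_y g q) * poly (pderiv p) (crd_z q)
   + (d_y f q * d_z g q - d_z f q * d_y g q) * crd_y q
   + (d_z f q * d_x g q - d_x f q * d_z g q) * crd_x q"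

text \<open>The partials \<open>Sy\<close> and \<open>Sz\<close> of the quotient are never computed.
  Differentiating \<open>y * S = p (z + T) - p z\<close> in \<open>z\<close> and in \<open>y\<close>
  gives \<open>Sz_eq\<close> and \<open>S_eq\<close>, which express \<open>p' z\<close> and
  \<open>S\<close> through them; after that the claim is a ring identity.\<close>

lemma poisson_vflow:
  assumes f: "f \<in> polyfun xyz" and g: "g \<in> polyfun xyz"
  shows "poisson p (\<lambda>u. f (vflow p a b u)) (\<lambda>u. g (vflow p a b u)) q = poisson p f g (vflow p a b q)"
proof (cases q)
  case (fields x y z)
  define T where "T = (a + b * y) * y"
  define P where "P = vflow p a b (x, y, z)"
  define S where "S = (\<lambda>u. diff_quot p (a + b * crd_y u) (crd_y u) (crd_z u))"
  have S: "S \<in> polyfun xyz" unfolding S_def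
    by (intro polyfun_diff_quot polyfun.add polyfun.mult polyfun.const polyfun_crd)
  define Sy where "Sy = d_y S (x, y, z)"
  define Sz where "Sz = d_z S (x, y, z)"
  have Sy: "((\<lambda>s. diff_quot p (a + b * s) s z) has_field_derivative Sy) (at y)"
    using polyfun_partials(2)[OF S, of x z y] by (simp add: S_def Sy_def)
  have Sz: "((\<lambda>s. diff_quot p (a + b * y) y s) has_field_derivative Sz) (at z)"
    using polyfun_partials(3)[OF S, of x y z] by (simp add: S_def Sz_def)
  have DT: "((\<lambda>s. z + (a + b * s) * s) has_field_derivative a + 2 * b * y) (at y)"
    by (auto intro!: derivative_eq_intros simp: algebra_simps)
  have partials: "d_x (\<lambda>u. h (vflow p a b u)) q = d_x h P"
    "d_y (\<lambda>u. h (vflow p a b u)) q = d_x h P * Sy + d_y h P + d_z h P * (a + 2 * b * y)"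
    "d_z (\<lambda>u. h (vflow p a b u)) q = d_x h P * Sz + d_z h P"
    if h: "h \<in> polyfun xyz" for h
  proof -
    have "((\<lambda>s. h (s + diff_quot p (a + b * y) y z, y, z + T)) has_field_derivative d_x h P) (at x)"
      using polyfun_xyz_chain[where X = "\<lambda>s. s + diff_quot p (a + b * y) y z" and Y = "\<lambda>_. y"
          and Z = "\<lambda>_. z + T" and s = x, OF h DERIV_add[OF DERIV_ident DERIV_const] DERIV_const DERIV_const]
      by (simp add: P_def vflow_simp T_def)
    then show "d_x (\<lambda>u. h (vflow p a b u)) q = d_x h P"
      by (simp add: d_x_def fields vflow_simp T_def DERIV_imp_deriv)
    have "((\<lambda>s. h (x + diff_quot p (a + b * s) s z, s, z + (a + b * s) * s)) has_field_derivative
        d_x h P * Sy + d_y h P + d_z h P * (a + 2 * b * y)) (at y)"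
      using polyfun_xyz_chain[where X = "\<lambda>s. x + diff_quot p (a + b * s) s z" and Y = "\<lambda>s. s"
          and Z = "\<lambda>s. z + (a + b * s) * s" and s = y, OF h DERIV_add[OF DERIV_const Sy] DERIV_ident DT]
      by (simp add: P_def vflow_simp T_def)
    then show "d_y (\<lambda>u. h (vflow p a b u)) q = d_x h P * Sy + d_y h P + d_z h P * (a + 2 * b * y)"
      by (simp add: d_y_def fields vflow_simp DERIV_imp_deriv)
    have "((\<lambda>s. h (x + diff_quot p (a + b * y) y s, y, s + T)) has_field_derivative
        d_x h P * Sz + d_z h P) (at z)"
      using polyfun_xyz_chain[where X = "\<lambda>s. x + diff_quot p (a + b * y) y s" and Y = "\<lambda>_. y"
          and Z = "\<lambda>s. s + T" and s = z,
          OF h DERIV_add[OF DERIV_const Sz] DERIV_const DERIV_add[OF DERIV_ident DERIV_const]]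
      by (simp add: P_def vflow_simp T_def)
    then show "d_z (\<lambda>u. h (vflow p a b u)) q = d_x h P * Sz + d_z h P"
      by (simp add: d_z_def fields vflow_simp T_def DERIV_imp_deriv)
  qed
  define p1 where "p1 = poly (pderiv p) (z + T)"
  have shift: "((\<lambda>s. poly p (e s)) has_field_derivative poly (pderiv p) (e s0) * e') (at s0)"
    if "(e has_field_derivative e') (at s0)" for e e' s0
    by (rule DERIV_chain2[OF poly_DERIV that])
  have "((\<lambda>s. y * diff_quot p (a + b * y) y s) has_field_derivative p1 - poly (pderiv p) z) (at z)"
    unfolding diff_quot_mult p1_def T_def
    using DERIV_diff[OF shift[OF DERIV_add[OF DERIV_ident DERIV_const]] poly_DERIV] by simp
  then have Sz_eq: "poly (pderiv p) z = p1 - y * Sz"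
    using DERIV_unique[OF DERIV_cmult[OF Sz]] by fastforce
  have "((\<lambda>s. s * diff_quot p (a + b * s) s z) has_field_derivative p1 * (a + 2 * b * y)) (at y)"
    unfolding diff_quot_mult p1_def T_def
    using DERIV_diff[OF shift[OF DT] DERIV_const] by simp
  then have "1 * diff_quot p (a + b * y) y z + Sy * y = p1 * (a + 2 * b * y)"
    using DERIV_unique[OF DERIV_mult[OF DERIV_ident Sy]] by blast
  then have S_eq: "diff_quot p (a + b * y) y z = p1 * (a + 2 * b * y) - Sy * y" by (simp add: algebra_simps)
  have P: "vflow p a b q = P" "crd_x P = x + (p1 * (a + 2 * b * y) - Sy * y)" "crd_y P = y"
      "poly (pderiv p) (crd_z P) = p1"
    by (simp_all add: P_def fields vflow_simp S_eq p1_def T_def)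
  have q: "crd_x q = x" "crd_y q = y" "poly (pderiv p) (crd_z q) = p1 - y * Sz"
    by (simp_all add: fields Sz_eq)
  show ?thesis
    unfolding poisson_def partials[OF f] partials[OF g] P q by (simp add: algebra_simps)
qed

text \<open>The bracket is the Jacobian determinant of \<open>f\<close>, \<open>g\<close> and
  \<open>x y - p z\<close>. The swap fixes the third function and has determinant -1, hence the
  sign; it occurs twice in \<open>wflow\<close>, where the signs cancel.\<close>

lemma poisson_swap: "poisson p (\<lambda>u. f (swap u)) (\<lambda>u. g (swap u)) q = - poisson p f g (swap q)"
  by (cases q) (simp add: poisson_def swap_def d_x_def d_y_def d_z_def algebra_simps)

lemma polyfun_xyz_subst:
  assumes "f \<in> polyfun xyz" "(\<lambda>u. crd_x (\<phi> u)) \<in> polyfun B" "(\<lambda>u. crd_y (\<phi> u)) \<in> polyfun B"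
    "(\<lambda>u. crd_z (\<phi> u)) \<in> polyfun B"
  shows "(\<lambda>u. f (\<phi> u)) \<in> polyfun B"
  by (rule polyfun_subst[OF assms(1)]) (use assms in \<open>auto simp: xyz_def\<close>)

lemma crd_swap: "crd_x (swap q) = crd_y q" "crd_y (swap q) = crd_x q" "crd_z (swap q) = crd_z q"
  by (cases q; simp add: swap_def)+

lemma crd_vflow:
  "crd_x (vflow p a b q) = crd_x q + diff_quot p (a + b * crd_y q) (crd_y q) (crd_z q)"
  "crd_y (vflow p a b q) = crd_y q"
  "crd_z (vflow p a b q) = crd_z q + (a + b * crd_y q) * crd_y q"
  by (cases q; simp add: vflow_simp)+

lemma polyfun_swap: "f \<in> polyfun xyz \<Longrightarrow> (\<lambda>u. f (swap u)) \<in> polyfun xyz"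
  by (erule polyfun_xyz_subst) (simp_all add: crd_swap polyfun_crd)

lemma polyfun_vflow: "f \<in> polyfun xyz \<Longrightarrow> (\<lambda>u. f (vflow p a b u)) \<in> polyfun xyz"
  by (erule polyfun_xyz_subst; unfold crd_vflow)
    (intro polyfun_diff_quot polyfun.add polyfun.mult polyfun.const polyfun_crd)+

lemma polyfun_wflow: "f \<in> polyfun xyz \<Longrightarrow> (\<lambda>u. f (wflow p a b u)) \<in> polyfun xyz"
  unfolding wflow_def
  using polyfun_swap[OF polyfun_vflow[OF polyfun_swap]] by blast

lemma poisson_wflow:
  assumes "f \<in> polyfun xyz" "g \<in> polyfun xyz"
  shows "poisson p (\<lambda>u. f (wflow p a b u)) (\<lambda>u. g (wflow p a b u)) q = poisson p f g (wflow p a b q)"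
proof -
  have "poisson p (\<lambda>u. f (wflow p a b u)) (\<lambda>u. g (wflow p a b u)) q
      = - poisson p (\<lambda>u. f (swap (vflow p a b u))) (\<lambda>u. g (swap (vflow p a b u))) (swap q)"
    unfolding wflow_def
    by (rule poisson_swap[of p "\<lambda>u. f (swap (vflow p a b u))" "\<lambda>u. g (swap (vflow p a b u))"])
  also have "\<dots> = - poisson p (\<lambda>u. f (swap u)) (\<lambda>u. g (swap u)) (vflow p a b (swap q))"
    using poisson_vflow[OF polyfun_swap[OF assms(1)] polyfun_swap[OF assms(2)]] by simp
  also have "\<dots> = poisson p f g (wflow p a b q)" by (simp add: poisson_swap wflow_def)
  finally show ?thesis .
qed

lemma polyfun_moves:
  assumes "g \<in> moves p" "f \<in> polyfun xyz" shows "(\<lambda>u. f (g u)) \<in> polyfun xyz"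
  using assms
proof (induction arbitrary: f rule: moves.induct)
  case (vflow g a b)
  from vflow.IH[OF polyfun_vflow[OF vflow.prems]] show ?case .
next
  case (wflow g a b)
  from wflow.IH[OF polyfun_wflow[OF wflow.prems]] show ?case .
qed simp

lemma poisson_moves:
  assumes "g \<in> moves p" "f \<in> polyfun xyz" "h \<in> polyfun xyz"
  shows "poisson p (\<lambda>u. f (g u)) (\<lambda>u. h (g u)) q = poisson p f h (g q)"
  using assms
proof (induction arbitrary: f h rule: moves.induct)
  case (vflow g a b)
  from vflow.IH[OF polyfun_vflow polyfun_vflow, OF vflow.prems] show ?case
    by (simp add: poisson_vflow vflow.prems)
next
  case (wflow g a b)
  from wflow.IH[OF polyfun_wflow polyfun_wflow, OF wflow.prems] show ?case
    by (simp add: poisson_wflow wflow.prems)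
qed simp

lemma poisson_linear:
  assumes "f \<in> polyfun xyz" "g \<in> polyfun xyz"
  shows "poisson p (\<lambda>u. c * f u + d * g u) h q = c * poisson p f h q + d * poisson p g h q"
proof (cases q)
  case (fields x y z)
  have "d_x (\<lambda>u. c * f u + d * g u) q = c * d_x f q + d * d_x g q"
    using DERIV_add[OF DERIV_cmult DERIV_cmult, OF polyfun_partials(1) polyfun_partials(1), OF assms]
    by (simp add: d_x_def[of "\<lambda>u. c * f u + d * g u"] fields DERIV_imp_deriv)
  moreover have "d_y (\<lambda>u. c * f u + d * g u) q = c * d_y f q + d * d_y g q"
    using DERIV_add[OF DERIV_cmult DERIV_cmult, OF polyfun_partials(2) polyfun_partials(2), OF assms]
    by (simp add: d_y_def[of "\<lambda>u. c * f u + d * g u"] fields DERIV_imp_deriv)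
  moreover have "d_z (\<lambda>u. c * f u + d * g u) q = c * d_z f q + d * d_z g q"
    using DERIV_add[OF DERIV_cmult DERIV_cmult, OF polyfun_partials(3) polyfun_partials(3), OF assms]
    by (simp add: d_z_def[of "\<lambda>u. c * f u + d * g u"] fields DERIV_imp_deriv)
  ultimately show ?thesis by (simp add: poisson_def algebra_simps)
qed

section \<open>Families of group elements and their velocities\<close>

definition sxyz :: "(complex \<times> C3 \<Rightarrow> complex) set" where
  "sxyz = insert fst ((\<lambda>b w. b (snd w)) ` xyz)"

text \<open>No group law in \<open>s\<close> is demanded, so composites and conjugates of families
  are again families. Polynomial dependence is joint in time and point, which makes a composite of
  several families polynomial in all its times.\<close>

definition flow_family :: "complex poly \<Rightarrow> (complex \<Rightarrow> C3 \<Rightarrow> C3) \<Rightarrow> bool" where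
  "flow_family p h \<longleftrightarrow> (\<forall>s. h s \<in> moves p) \<and> (\<forall>q. h 0 q = q) \<and>
    (\<forall>f\<in>polyfun xyz. (\<lambda>w. f (h (fst w) (snd w))) \<in> polyfun sxyz)"

lemma flow_family_moves: "flow_family p h \<Longrightarrow> h s \<in> moves p" and flow_family_0: "flow_family p h \<Longrightarrow> h 0 q = q"
  unfolding flow_family_def by (elim conjE, erule spec)+

lemma flow_family_subst:
  assumes h: "flow_family p h" and f: "f \<in> polyfun xyz" and \<sigma>: "\<sigma> \<in> polyfun B"
    and \<phi>: "\<And>g. g \<in> polyfun xyz \<Longrightarrow> (\<lambda>u. g (\<phi> u)) \<in> polyfun B"
  shows "(\<lambda>u. f (h (\<sigma> u) (\<phi> u))) \<in> polyfun B"
proof -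
  have 1: "(\<lambda>w. f (h (fst w) (snd w))) \<in> polyfun sxyz" using h f by (auto simp: flow_family_def)
  have "(\<lambda>u. (\<lambda>w. f (h (fst w) (snd w))) (\<sigma> u, \<phi> u)) \<in> polyfun B"
  proof (rule polyfun_subst[OF 1])
    fix b assume "b \<in> sxyz"
    then show "(\<lambda>u. b (\<sigma> u, \<phi> u)) \<in> polyfun B"
      using \<sigma> \<phi> polyfun.base[of _ xyz] by (auto simp: sxyz_def)
  qed
  then show ?thesis by simp
qed

lemma polyfun_sxyz:
  "fst \<in> polyfun sxyz" "g \<in> polyfun xyz \<Longrightarrow> (\<lambda>w. g (snd w)) \<in> polyfun sxyz"
proof -
  show "fst \<in> polyfun sxyz" by (rule polyfun.base) (simp add: sxyz_def)
  show "(\<lambda>w. g (snd w)) \<in> polyfun sxyz" if "g \<in> polyfun xyz"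
    by (rule polyfun_subst[OF that], rule polyfun.base) (simp add: sxyz_def)
qed

definition hamiltonians :: "complex poly \<Rightarrow> (C3 \<Rightarrow> complex) set" where
  "hamiltonians p = {K \<in> polyfun xyz. \<exists>h. flow_family p h \<and>
     (\<forall>f\<in>polyfun xyz. \<forall>q. ((\<lambda>s. f (h s q)) has_field_derivative poisson p K f q) (at 0))}"

lemma hamiltonians_linear:
  assumes "K \<in> hamiltonians p" "L \<in> hamiltonians p"
  shows "(\<lambda>q. c * K q + d * L q) \<in> hamiltonians p"
proof -
  obtain h where K: "K \<in> polyfun xyz" and h: "flow_family p h"
    and Dh: "\<forall>f\<in>polyfun xyz. \<forall>q. ((\<lambda>s. f (h s q)) has_field_derivative poisson p K f q) (at 0)"
    using assms(1) unfolding hamiltonians_def by blast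
  obtain k where L: "L \<in> polyfun xyz" and k: "flow_family p k"
    and Dk: "\<forall>f\<in>polyfun xyz. \<forall>q. ((\<lambda>s. f (k s q)) has_field_derivative poisson p L f q) (at 0)"
    using assms(2) unfolding hamiltonians_def by blast
  define l where "l = (\<lambda>s q. h (c * s) (k (d * s) q))"
  have "flow_family p l" unfolding flow_family_def
  proof (intro conjI allI ballI)
    show "l s \<in> moves p" for s
      unfolding l_def by (rule moves_comp[OF flow_family_moves[OF h, of "c * s"] flow_family_moves[OF k, of "d * s"]])
    show "l 0 q = q" for q
      unfolding l_def by (simp add: flow_family_0[OF h] flow_family_0[OF k])
    fix f assume f: "f \<in> polyfun xyz"
    show "(\<lambda>w. f (l (fst w) (snd w))) \<in> polyfun sxyz"
      unfolding l_def
    proof (rule flow_family_subst[OF h f, of "\<lambda>w. c * fst w" sxyz "\<lambda>w. k (d * fst w) (snd w)"])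
      show "(\<lambda>w. g (k (d * fst w) (snd w))) \<in> polyfun sxyz" if "g \<in> polyfun xyz" for g
        by (rule flow_family_subst[OF k that, of "\<lambda>w. d * fst w" sxyz snd])
          (rule polyfun.mult[OF polyfun.const polyfun_sxyz(1)], rule polyfun_sxyz(2))
    qed (rule polyfun.mult[OF polyfun.const polyfun_sxyz(1)])
  qed
  moreover have "((\<lambda>s. f (l s q)) has_field_derivative poisson p (\<lambda>q. c * K q + d * L q) f q) (at 0)"
    if f: "f \<in> polyfun xyz" for f q
  proof -
    \<comment> \<open>The two times are decoupled. On each axis the other family is the identity,
      which determines the gradient at the origin; the family \<open>l\<close> is the line in
      direction \<open>(c, d)\<close>.\<close>
    define F where "F = (\<lambda>w. f (h (fst w) (k (snd w) q)))"
    have "F \<in> polyfun {fst, snd}" unfolding F_def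
    proof (rule flow_family_subst[OF h f, of fst _ "\<lambda>w. k (snd w) q"])
      show "(\<lambda>w. g (k (snd w) q)) \<in> polyfun {fst, snd}" if "g \<in> polyfun xyz" for g
        by (rule flow_family_subst[OF k that, of snd _ "\<lambda>_. q"]) (auto intro: polyfun.base polyfun.const)
    qed (auto intro: polyfun.base)
    then obtain e where e: "gradient_at {fst, snd} (0, 0) e F"
      using polyfun_gradient[of F "{fst, snd}" "(0, 0)"] by auto
    have ne: "(fst :: complex \<times> complex \<Rightarrow> complex) \<noteq> snd"
    proof -
      have "(fst (1, 0) :: complex) \<noteq> snd (1, 0 :: complex)" by simp
      then show ?thesis by metis
    qed
    have line: "((\<lambda>s. F (x * s, y * s)) has_field_derivative e fst * x + e snd * y) (at 0)" for x y
    proof -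
      have "((\<lambda>s. F (x * s, y * s)) has_field_derivative
          (\<Sum>b\<in>{fst, snd}. e b * (if b = fst then x else y))) (at 0)"
        by (rule gradient_atD[OF e, where \<gamma> = "\<lambda>s. (x * s, y * s)"])
          (use ne in \<open>auto intro!: derivative_eq_intros\<close>)
      then show ?thesis using ne by simp
    qed
    have "((\<lambda>s. F (1 * s, 0 * s)) has_field_derivative poisson p K f q) (at 0)"
      using Dh[rule_format, OF f, of q] by (simp add: F_def flow_family_0[OF k])
    from DERIV_unique[OF line this] have e1: "e fst = poisson p K f q" by simp
    have "((\<lambda>s. F (0 * s, 1 * s)) has_field_derivative poisson p L f q) (at 0)"
      using Dk[rule_format, OF f, of q] by (simp add: F_def flow_family_0[OF h])
    from DERIV_unique[OF line this] have e2: "e snd = poisson p L f q" by simp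
    show ?thesis using line[of c d]
      by (simp add: F_def l_def e1 e2 poisson_linear[OF K L] mult.commute)
  qed
  ultimately show ?thesis
    using K L by (auto simp: hamiltonians_def intro!: polyfun.add polyfun.mult polyfun.const)
qed

lemma hamiltonians_scale: "K \<in> hamiltonians p \<Longrightarrow> (\<lambda>q. c * K q) \<in> hamiltonians p"
  using hamiltonians_linear[of K p K c 0] by simp

lemma hamiltonians_add: "K \<in> hamiltonians p \<Longrightarrow> L \<in> hamiltonians p \<Longrightarrow> (\<lambda>q. K q + L q) \<in> hamiltonians p"
  using hamiltonians_linear[of K p L 1 1] by simp

text \<open>If \<open>h\<close> belongs to \<open>K\<close>, then the conjugates \<open>g\<^sup>-\<^sup>1 h g\<close> belong to \<open>K \<circ> g\<close>, because \<open>g\<close>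
  preserves the bracket.\<close>

lemma hamiltonians_moves:
  assumes "K \<in> hamiltonians p" "g \<in> moves p"
  shows "(\<lambda>q. K (g q)) \<in> hamiltonians p"
proof -
  obtain h where K: "K \<in> polyfun xyz" and h: "flow_family p h"
    and Dh: "\<forall>f\<in>polyfun xyz. \<forall>q. ((\<lambda>s. f (h s q)) has_field_derivative poisson p K f q) (at 0)"
    using assms(1) unfolding hamiltonians_def by blast
  obtain g' where g': "g' \<in> moves p" "\<And>q. g' (g q) = q" "\<And>q. g (g' q) = q"
    using moves_inverse[OF assms(2)] by blast
  define l where "l = (\<lambda>s q. g' (h s (g q)))"
  have "flow_family p l" unfolding flow_family_def
  proof (intro conjI allI ballI)
    show "l s \<in> moves p" for s
      unfolding l_def
      by (rule moves_comp[OF g'(1)], rule moves_comp[OF flow_family_moves[OF h, of s] assms(2)])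
    show "l 0 q = q" for q
      unfolding l_def by (simp add: flow_family_0[OF h] g')
    fix f assume f: "f \<in> polyfun xyz"
    show "(\<lambda>w. f (l (fst w) (snd w))) \<in> polyfun sxyz"
      unfolding l_def
      by (rule flow_family_subst[OF h polyfun_moves[OF g'(1) f]])
        (auto intro: polyfun_sxyz polyfun_moves[OF assms(2)])
  qed
  moreover have "((\<lambda>s. f (l s q)) has_field_derivative poisson p (\<lambda>q. K (g q)) f q) (at 0)"
    if f: "f \<in> polyfun xyz" for f q
  proof -
    have "poisson p K (\<lambda>u. f (g' u)) (g q) = poisson p (\<lambda>u. K (g u)) (\<lambda>u. f (g' (g u))) q"
      using poisson_moves[OF assms(2) K polyfun_moves[OF g'(1) f]] by simp
    then show ?thesis using Dh[rule_format, OF polyfun_moves[OF g'(1) f], of "g q"] by (simp add: l_def g')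
  qed
  ultimately show ?thesis
    using polyfun_moves[OF assms(2) K] by (auto simp: hamiltonians_def)
qed

lemma hamiltonians_y: "crd_y \<in> hamiltonians p"
proof -
  have "flow_family p (\<lambda>s. vflow p s 0)" unfolding flow_family_def
    by (intro conjI allI ballI vflow_moves vflow_0)
      (erule polyfun_xyz_subst; unfold crd_vflow;
       intro polyfun_diff_quot polyfun.add polyfun.mult polyfun.const polyfun_sxyz polyfun_crd)
  moreover have "((\<lambda>s. f (vflow p s 0 q)) has_field_derivative poisson p crd_y f q) (at 0)"
    if f: "f \<in> polyfun xyz" for f q
  proof (cases q)
    case (fields x y z)
    have "((\<lambda>t. diff_quot p t y z) has_field_derivative poly (pderiv p) z) (at 0)"
    proof (cases "y = 0")
      case True
      then show ?thesis by (simp add: diff_quot_0) (auto intro!: derivative_eq_intros)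
    next
      case False
      have "((\<lambda>t. poly p (z + t * y)) has_field_derivative poly (pderiv p) (z + 0 * y) * y) (at 0)"
        by (rule DERIV_chain2[OF poly_DERIV]) (auto intro!: derivative_eq_intros)
      from DERIV_cdivide[OF DERIV_diff[OF this DERIV_const], of "poly p z" y] False
      show ?thesis by (simp add: diff_quot_eq)
    qed
    from polyfun_xyz_chain[where X = "\<lambda>t. x + diff_quot p t y z" and Y = "\<lambda>_. y" and Z = "\<lambda>t. z + t * y"
        and s = 0, OF f DERIV_add[OF DERIV_const this] DERIV_const
        DERIV_add[OF DERIV_const DERIV_mult[OF DERIV_ident DERIV_const]]]
    show ?thesis
      by (simp add: fields vflow_simp poisson_def d_x_def[of crd_y] d_y_def[of crd_y] d_z_def[of crd_y])
  qed
  ultimately show ?thesis using polyfun_crd by (auto simp: hamiltonians_def)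
qed

lemma hamiltonians_sum:
  assumes "\<And>i. i \<in> I \<Longrightarrow> K i \<in> hamiltonians p" shows "(\<lambda>q. \<Sum>i\<in>I. K i q) \<in> hamiltonians p"
proof -
  have "(\<lambda>q. 0) \<in> hamiltonians p" using hamiltonians_scale[OF hamiltonians_y, of 0 p] by simp
  with assms show ?thesis
    by (induction I rule: infinite_finite_induct) (auto intro: hamiltonians_add)
qed

text \<open>Passing from \<open>u t\<close> to \<open>u (2 t) - 2 ^ n u t\<close> removes the top coefficient and only rescales
  the others.\<close>

lemma hamiltonians_coefficient:
  assumes "\<And>t. (\<lambda>q. \<Sum>k\<le>n. t ^ k * v k q) \<in> hamiltonians p" "k \<le> n"
  shows "v k \<in> hamiltonians p"
  using assms
proof (induction n arbitrary: v k)
  case 0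
  then show ?case using "0.prems"(1)[of 0] by simp
next
  case (Suc n)
  define w where "w = (\<lambda>k q. (2 ^ k - 2 ^ Suc n) * v k q)"
  have "(\<lambda>q. \<Sum>k\<le>n. t ^ k * w k q) \<in> hamiltonians p" for t
  proof -
    have "(\<lambda>q. 1 * (\<Sum>k\<le>Suc n. (2 * t) ^ k * v k q) + - (2 ^ Suc n) * (\<Sum>k\<le>Suc n. t ^ k * v k q)) \<in> hamiltonians p"
      by (intro hamiltonians_linear Suc.prems)
    also have "(\<lambda>q. 1 * (\<Sum>k\<le>Suc n. (2 * t) ^ k * v k q) + - (2 ^ Suc n) * (\<Sum>k\<le>Suc n. t ^ k * v k q))
        = (\<lambda>q. \<Sum>k\<le>n. t ^ k * w k q)"
      by (simp add: w_def fun_eq_iff sum_distrib_left sum_subtractf sum_negf power_mult_distrib algebra_simps)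
    finally show ?thesis .
  qed
  from Suc.IH[OF this] have w: "w k \<in> hamiltonians p" if "k \<le> n" for k using that .
  have v: "v k \<in> hamiltonians p" if "k \<le> n" for k
  proof -
    have "(2::complex) ^ k \<noteq> 2 ^ Suc n"
    proof -
      have "(2::nat) ^ k \<noteq> 2 ^ Suc n" using that by (subst power_inject_exp) auto
      then have "of_nat (2 ^ k) \<noteq> (of_nat (2 ^ Suc n) :: complex)" by (metis of_nat_eq_iff)
      then show ?thesis by simp
    qed
    then show ?thesis using hamiltonians_scale[OF w[OF that], of "1 / (2 ^ k - 2 ^ Suc n)"] by (simp add: w_def)
  qed
  show ?case
  proof (cases "k = Suc n")
    case True
    have "(\<lambda>q. 1 * (\<Sum>k\<le>Suc n. 1 ^ k * v k q) + - 1 * (\<Sum>k\<le>n. v k q)) \<in> hamiltonians p"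
      by (rule hamiltonians_linear[OF Suc.prems(1) hamiltonians_sum]) (use v in auto)
    then show ?thesis using True by simp
  qed (use v Suc.prems in auto)
qed

subsection \<open>Powers of y among the Hamiltonian functions\<close>

definition yz_mono :: "nat \<Rightarrow> complex poly \<Rightarrow> C3 \<Rightarrow> complex" where
  "yz_mono k r q = crd_y q ^ k * poly r (crd_z q)"

text \<open>The flows of \<open>V\<close> and \<open>y V\<close> fix \<open>y\<close> and shift
  \<open>z\<close> by \<open>t * y\<close> and \<open>t * y ^ 2\<close>. By Taylor's formula the
  coefficient of \<open>t ^ j\<close> is the claimed function up to the factor
  \<open>fact j\<close>.\<close>

lemma hamiltonians_yz_mono_V:
  assumes "yz_mono k r \<in> hamiltonians p"
  shows "yz_mono (k + j) ((pderiv ^^ j) r) \<in> hamiltonians p" "yz_mono (k + 2 * j) ((pderiv ^^ j) r) \<in> hamiltonians p"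
proof -
  have *: "yz_mono (k + e * j) ((pderiv ^^ j) r) \<in> hamiltonians p"
    if mv: "\<And>t. \<exists>g\<in>moves p. \<forall>q. crd_y (g q) = crd_y q \<and> crd_z (g q) = crd_z q + t * crd_y q ^ e" for e
  proof -
    define v where "v = (\<lambda>j. yz_mono (k + e * j) (smult (1 / fact j) ((pderiv ^^ j) r)))"
    have "(\<lambda>q. \<Sum>j\<le>degree r. t ^ j * v j q) \<in> hamiltonians p" for t
    proof -
      obtain g where g: "g \<in> moves p"
        "\<forall>q. crd_y (g q) = crd_y q \<and> crd_z (g q) = crd_z q + t * crd_y q ^ e" using mv by blast
      have "(\<Sum>j\<le>degree r. t ^ j * v j q) = yz_mono k r (g q)" for q
        unfolding yz_mono_def v_def g(2)[rule_format, THEN conjunct1] g(2)[rule_format, THEN conjunct2]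
          poly_taylor[of r "crd_z q"] sum_distrib_left
        by (rule sum.cong) (simp_all add: power_add power_mult power_mult_distrib)
      then show ?thesis using hamiltonians_moves[OF assms g(1)] by simp
    qed
    note v = hamiltonians_coefficient[OF this]
    show ?thesis
    proof (cases "j \<le> degree r")
      case True
      have "(\<lambda>q. fact j * v j q) = yz_mono (k + e * j) ((pderiv ^^ j) r)"
        by (simp add: v_def yz_mono_def fun_eq_iff)
      then show ?thesis using hamiltonians_scale[OF v[OF True], of "fact j"] by simp
    next
      case False
      then obtain i where i: "j = Suc i" "i \<ge> degree r" by (cases j) auto
      then have "degree ((pderiv ^^ i) r) = 0" by (simp add: degree_higher_pderiv)
      then have "(pderiv ^^ j) r = 0" using i by (simp add: pderiv_eq_0_iff)
      then have "yz_mono (k + e * j) ((pderiv ^^ j) r) = (\<lambda>q. 0 * crd_y q)"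
        by (simp add: yz_mono_def fun_eq_iff)
      then show ?thesis using hamiltonians_scale[OF hamiltonians_y, of 0 p] by simp
    qed
  qed
  have "\<exists>g\<in>moves p. \<forall>q. crd_y (g q) = crd_y q \<and> crd_z (g q) = crd_z q + t * crd_y q ^ 1" for t
    by (rule bexI[OF _ vflow_moves[of p t 0]]) (simp add: crd_vflow)
  from *[OF this] show "yz_mono (k + j) ((pderiv ^^ j) r) \<in> hamiltonians p" by simp
  have "\<exists>g\<in>moves p. \<forall>q. crd_y (g q) = crd_y q \<and> crd_z (g q) = crd_z q + t * crd_y q ^ 2" for t
    by (rule bexI[OF _ vflow_moves[of p 0 t]]) (simp add: crd_vflow power2_eq_square)
  from *[OF this] show "yz_mono (k + 2 * j) ((pderiv ^^ j) r) \<in> hamiltonians p" .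
qed

text \<open>Along the flow of \<open>W\<close> the coordinate \<open>y\<close> becomes
  \<open>y + t * p' z\<close> plus higher powers of \<open>t\<close>, so \<open>y ^ n\<close> has
  the linear coefficient \<open>n * y ^ (n - 1) * p' z\<close>.\<close>

lemma hamiltonians_yz_mono_W:
  assumes "yz_mono n 1 \<in> hamiltonians p" "n \<ge> 1"
  shows "yz_mono (n - 1) (pderiv p) \<in> hamiltonians p"
proof (cases "degree p = 0")
  case True
  then have "pderiv p = 0" by (simp add: pderiv_eq_0_iff)
  then have "yz_mono (n - 1) (pderiv p) = (\<lambda>q. 0 * crd_y q)" by (simp add: yz_mono_def fun_eq_iff)
  then show ?thesis using hamiltonians_scale[OF hamiltonians_y, of 0 p] by simp
next
  case False
  \<comment> \<open>For fixed \<open>q\<close>, the \<open>y\<close>-coordinate along the flow of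
    \<open>W\<close> as a polynomial in time; this bounds the degree in \<open>t\<close> and makes
    the coefficients accessible.\<close>
  define R where "R = (\<lambda>q. [:crd_y q:] + (\<Sum>k=1..degree p.
    monom (inverse (fact k) * crd_x q ^ (k - 1) * poly ((pderiv ^^ k) p) (crd_z q)) k))"
  have R: "poly (R q) t = crd_y (wflow p t 0 q)" for q t
    by (simp add: R_def wflow_def crd_swap crd_vflow diff_quot_def poly_sum poly_monom mult_ac)
  have "degree (R q) \<le> degree p" for q
    unfolding R_def by (intro degree_add_le degree_sum_le) (auto intro: order_trans[OF degree_monom_le])
  then have deg: "degree (R q ^ n) \<le> degree p * n" for q
    using degree_power_le[of "R q" n] mult_le_mono1 order_trans by blast
  define v where "v = (\<lambda>k q. coeff (R q ^ n) k)"
  have "(\<lambda>q. \<Sum>k\<le>degree p * n. t ^ k * v k q) \<in> hamiltonians p" for t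
  proof -
    have "(\<Sum>k\<le>degree p * n. t ^ k * v k q) = yz_mono n 1 (wflow p t 0 q)" for q
    proof -
      have "poly (R q ^ n) t = (\<Sum>k\<le>degree p * n. v k q * t ^ k)"
        unfolding v_def poly_altdef using deg[of q]
        by (intro sum.mono_neutral_left) (auto simp: coeff_eq_0)
      then show ?thesis by (simp add: yz_mono_def R mult.commute)
    qed
    then show ?thesis using hamiltonians_moves[OF assms(1) wflow_moves] by simp
  qed
  from hamiltonians_coefficient[OF this, of 1] False assms(2) have v1: "v 1 \<in> hamiltonians p" by simp
  have "v 1 q = of_nat n * yz_mono (n - 1) (pderiv p) q" for q
  proof -
    have "v 1 q = poly (pderiv (R q ^ n)) 0"
      by (simp add: v_def poly_0_coeff_0 coeff_pderiv)
    also have "\<dots> = of_nat n * (poly (R q) 0 ^ (n - 1) * poly (pderiv (R q)) 0)"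
      by (simp add: pderiv_power)
    also have "poly (R q) 0 = crd_y q" by (simp add: R)
    also have "poly (pderiv (R q)) 0 = coeff (R q) 1"
      by (simp add: poly_0_coeff_0 coeff_pderiv)
    also have "\<dots> = (\<Sum>k=1..degree p. if k = 1 then poly (pderiv p) (crd_z q) else 0)"
      unfolding R_def coeff_add coeff_sum by (simp add: coeff_pCons)
    also have "\<dots> = poly (pderiv p) (crd_z q)" using False by simp
    finally show ?thesis by (simp add: yz_mono_def)
  qed
  then have "(\<lambda>q. (1 / of_nat n) * v 1 q) = yz_mono (n - 1) (pderiv p)"
    using assms(2) by (simp add: fun_eq_iff)
  then show ?thesis using hamiltonians_scale[OF v1, of "1 / of_nat n"] by simp
qed

text \<open>One use of \<open>W\<close>, then \<open>a\<close> derivatives by \<open>V\<close> and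
  \<open>b\<close> by \<open>y V\<close>. For \<open>a + b + 1 = degree p\<close> a pure power of
  \<open>y\<close> remains, one derivative earlier a linear polynomial in \<open>z\<close>.\<close>

lemma hamiltonians_yz_mono_step:
  assumes "yz_mono n 1 \<in> hamiltonians p" "n \<ge> 1"
  shows "yz_mono (n - 1 + a + 2 * b) ((pderiv ^^ Suc (a + b)) p) \<in> hamiltonians p"
proof -
  have "(pderiv ^^ b) ((pderiv ^^ a) (pderiv p)) = (pderiv ^^ Suc (a + b)) p"
    by (simp only: funpow_Suc_right o_apply add.commute[of a] funpow_add)
  then show ?thesis
    using hamiltonians_yz_mono_V(2)[OF hamiltonians_yz_mono_V(1)[OF hamiltonians_yz_mono_W[OF assms], of a], of b] by simp
qed

lemma higher_pderiv_degree:
  fixes p :: "complex poly"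
  assumes "degree p \<ge> 1"
  obtains c where "c \<noteq> 0" "(pderiv ^^ degree p) p = [:c:]"
proof -
  have "degree ((pderiv ^^ degree p) p) = 0" by (simp add: degree_higher_pderiv)
  then obtain c where c: "(pderiv ^^ degree p) p = [:c:]" by (rule degree_eq_zeroE)
  have "coeff ((pderiv ^^ degree p) p) 0 \<noteq> 0"
    using assms by (auto simp: coeff_higher_pderiv pochhammer_fact[symmetric])
  then show ?thesis using that c by auto
qed

text \<open>Starting from \<open>y\<close>, the exponents \<open>a + 2 * b\<close> with
  \<open>a + b = d - 1\<close> fill the interval from \<open>d - 1\<close> to
  \<open>2 * d - 2\<close>. It contains \<open>d\<close> consecutive numbers, and a further step
  raises an exponent by \<open>d - 1\<close>, so nothing above is missed.\<close>

lemma hamiltonians_y_power: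
  assumes d: "degree p \<ge> 2" and n: "n \<ge> degree p - 1"
  shows "yz_mono n 1 \<in> hamiltonians p"
proof -
  define d where "d = degree p"
  obtain c where c: "c \<noteq> 0" "(pderiv ^^ d) p = [:c:]"
    using higher_pderiv_degree[of p] assms unfolding d_def by auto
  have step: "yz_mono (m - 1 + a + 2 * b) 1 \<in> hamiltonians p"
    if "yz_mono m 1 \<in> hamiltonians p" "m \<ge> 1" "Suc (a + b) = d" for m a b
  proof -
    have "yz_mono (m - 1 + a + 2 * b) [:c:] \<in> hamiltonians p"
      using hamiltonians_yz_mono_step[OF that(1,2), of a b] c(2) that(3) by simp
    from hamiltonians_scale[OF this, of "1 / c"] show ?thesis
      using c(1) by (simp add: yz_mono_def[abs_def])
  qed
  have y1: "yz_mono 1 1 \<in> hamiltonians p" using hamiltonians_y by (simp add: yz_mono_def[abs_def])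
  show ?thesis using n
  proof (induction n rule: less_induct)
    case (less n)
    show ?case
    proof (cases "n \<le> 2 * d - 2")
      case True
      then show ?thesis
      proof -
        \<comment> \<open>The solution of \<open>a + b = d - 1\<close> and
          \<open>a + 2 * b = n\<close>; both are nonnegative exactly in this range of
          \<open>n\<close>.\<close>
        have "Suc (2 * d - 2 - n + (n - (d - 1))) = d" "1 - 1 + (2 * d - 2 - n) + 2 * (n - (d - 1)) = n"
          using True less.prems d unfolding d_def by linarith+
        with step[OF y1 le_refl] show ?thesis by metis
      qed
    next
      case False
      define m where "m = n - (d - 1)"
      have "yz_mono m 1 \<in> hamiltonians p"
        using False d by (intro less.IH) (auto simp: m_def d_def)
      show ?thesis
      proof -
        \<comment> \<open>Here \<open>a = d - 2\<close> and \<open>b = 1\<close>; one derivative by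
          \<open>y V\<close> offsets the loss caused by \<open>W\<close>, which requires
          \<open>d \<ge> 2\<close>.\<close>
        have "m \<ge> 1" "Suc (d - 2 + 1) = d" "m - 1 + (d - 2) + 2 * 1 = n"
          using False d unfolding m_def d_def by linarith+
        with step[OF \<open>yz_mono m 1 \<in> hamiltonians p\<close>] show ?thesis by metis
      qed
    qed
  qed
qed

text \<open>Stopping one derivative before \<open>p\<close> becomes constant leaves
  \<open>y ^ n\<close> times a linear polynomial in \<open>z\<close>, whose constant term is removed
  by the pure power \<open>y ^ n\<close>.\<close>

lemma hamiltonians_y_power_z:
  assumes d: "degree p \<ge> 2" and n: "n \<ge> 2 * degree p"
  shows "yz_mono n [:0, 1:] \<in> hamiltonians p"
proof -
  define d where "d = degree p"
  define r where "r = (pderiv ^^ (d - 1)) p"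
  have "degree r = 1" using assms by (simp add: r_def degree_higher_pderiv d_def)
  then obtain e c where r: "r = [:e, c:]" "c \<noteq> 0" using degree1_coeffs by metis
  \<comment> \<open>Chosen such that \<open>W\<close> (minus 1) followed by \<open>d - 2\<close>
    derivatives by \<open>V\<close> (plus \<open>d - 2\<close>) ends at exponent
    \<open>n\<close>.\<close>
  have "yz_mono (n + 3 - d) 1 \<in> hamiltonians p"
    using assms by (intro hamiltonians_y_power) (auto simp: d_def)
  from hamiltonians_yz_mono_step[OF this, of "d - 2" 0]
  have "yz_mono n [:e, c:] \<in> hamiltonians p"
    using assms by (simp add: d_def r(1)[symmetric] r_def Suc_diff_Suc numeral_2_eq_2 flip: funpow.simps)
  moreover have "yz_mono n 1 \<in> hamiltonians p" using assms by (intro hamiltonians_y_power) auto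
  ultimately have "(\<lambda>q. (1 / c) * yz_mono n [:e, c:] q + (- e / c) * yz_mono n 1 q) \<in> hamiltonians p"
    by (rule hamiltonians_linear)
  also have "(\<lambda>q. (1 / c) * yz_mono n [:e, c:] q + (- e / c) * yz_mono n 1 q) = yz_mono n [:0, 1:]"
    using r(2) by (simp add: yz_mono_def fun_eq_iff field_simps)
  finally show ?thesis .
qed

section \<open>Prescribing tangent vectors at finitely many points\<close>

lemma interpolation:
  fixes y w :: "'i \<Rightarrow> complex"
  assumes "finite I" "inj_on y I"
  shows "\<exists>c. \<forall>i\<in>I. poly c (y i) = w i"
  using assms
proof (induction I rule: finite_induct)
  case (insert j I)
  then obtain c where c: "\<forall>i\<in>I. poly c (y i) = w i" by auto
  define r where "r = (\<Prod>i\<in>I. [:- y i, 1:])"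
  have r0: "poly r (y i) = 0" if "i \<in> I" for i
    using that insert.hyps by (auto simp: r_def poly_prod intro!: bexI[of _ i])
  have r1: "poly r (y j) \<noteq> 0"
    using insert.hyps insert.prems by (auto simp: r_def poly_prod)
  have "\<forall>i\<in>insert j I. poly (c + smult ((w j - poly c (y j)) / poly r (y j)) r) (y i) = w i"
    using c r0 r1 by auto
  then show ?case by blast
qed auto

text \<open>For \<open>K = C(y) z + E(y)\<close> the bracket gives \<open>{K, y} = - y C(y)\<close>
  and \<open>{K, z} = y (C'(y) z + E'(y))\<close>. So first \<open>C\<close> is interpolated to
  match \<open>a\<close>, then \<open>E'\<close> to match \<open>b\<close> with the contribution of
  \<open>C\<close> subtracted.\<close>

lemma hamiltonians_tangent:
  assumes d: "degree p \<ge> 2" and "finite I" "inj_on (\<lambda>i. crd_y (q i)) I"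
    and nz: "\<And>i. i \<in> I \<Longrightarrow> crd_y (q i) \<noteq> 0"
  shows "\<exists>K\<in>hamiltonians p. \<forall>i\<in>I. poisson p K crd_y (q i) = a i \<and> poisson p K crd_z (q i) = b i"
proof -
  \<comment> \<open>From this exponent on all \<open>y ^ n\<close> and \<open>y ^ n z\<close> are
    available, so \<open>C\<close> and \<open>E'\<close> are sought as multiples of
    \<open>y ^ N\<close>.\<close>
  define N where "N = 2 * degree p"
  have interp: "\<exists>c. \<forall>i\<in>I. poly (monom 1 N * c) (crd_y (q i)) = w i" for w
  proof -
    obtain c where "\<forall>i\<in>I. poly c (crd_y (q i)) = w i / crd_y (q i) ^ N"
      using interpolation[OF assms(2,3), of "\<lambda>i. w i / crd_y (q i) ^ N"] by blast
    then show ?thesis using nz by (intro exI[of _ c]) (auto simp: poly_monom)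
  qed
  obtain c where c: "\<forall>i\<in>I. poly (monom 1 N * c) (crd_y (q i)) = - a i / crd_y (q i)"
    using interp[of "\<lambda>i. - a i / crd_y (q i)"] by blast
  define C where "C = monom 1 N * c"
  obtain e where e: "\<forall>i\<in>I. poly (monom 1 N * e) (crd_y (q i))
      = b i / crd_y (q i) - poly (pderiv C) (crd_y (q i)) * crd_z (q i)"
    using interp[of "\<lambda>i. b i / crd_y (q i) - poly (pderiv C) (crd_y (q i)) * crd_z (q i)"] by blast
  \<comment> \<open>The antiderivative of \<open>y ^ N e\<close> without constant term, so only
    exponents above \<open>N\<close> occur.\<close>
  define E where "E = (\<Sum>k\<le>degree e. monom (coeff e k / of_nat (N + k + 1)) (N + k + 1))"
  have "pderiv E = (\<Sum>k\<le>degree e. monom (coeff e k) (N + k))"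
    unfolding E_def higher_pderiv_sum[where n = 1, simplified] by (rule sum.cong) (auto simp: pderiv_monom simp del: of_nat_Suc of_nat_add)
  also have "\<dots> = monom 1 N * (\<Sum>k\<le>degree e. monom (coeff e k) k)"
    by (simp add: sum_distrib_left mult_monom)
  also have "\<dots> = monom 1 N * e" by (simp only: poly_as_sum_of_monoms)
  finally have dE: "pderiv E = monom 1 N * e" .
  define K where "K = (\<lambda>q. poly C (crd_y q) * crd_z q + poly E (crd_y q))"
  have "(\<lambda>q. \<Sum>k\<le>degree c. coeff c k * yz_mono (N + k) [:0, 1:] q) \<in> hamiltonians p"
    by (intro hamiltonians_sum hamiltonians_scale hamiltonians_y_power_z d) (simp add: N_def)
  moreover have "(\<Sum>k\<le>degree c. coeff c k * yz_mono (N + k) [:0, 1:] u) = poly C (crd_y u) * crd_z u" for u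
    by (simp add: C_def poly_monom poly_altdef[of c] sum_distrib_left sum_distrib_right yz_mono_def
        power_add mult_ac)
  ultimately have 1: "(\<lambda>q. poly C (crd_y q) * crd_z q) \<in> hamiltonians p" by simp
  have "(\<lambda>q. \<Sum>k\<le>degree e. (coeff e k / of_nat (N + k + 1)) * yz_mono (N + k + 1) 1 q) \<in> hamiltonians p"
    using d by (intro hamiltonians_sum hamiltonians_scale hamiltonians_y_power d) (simp add: N_def)
  moreover have "(\<Sum>k\<le>degree e. (coeff e k / of_nat (N + k + 1)) * yz_mono (N + k + 1) 1 u) = poly E (crd_y u)" for u
    by (simp add: E_def poly_sum poly_monom yz_mono_def)
  ultimately have 2: "(\<lambda>q. poly E (crd_y q)) \<in> hamiltonians p" by simp
  have K: "K \<in> hamiltonians p" unfolding K_def by (rule hamiltonians_add[OF 1 2])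
  have partials: "d_x K u = 0" "d_y K u = poly (pderiv C) (crd_y u) * crd_z u + poly (pderiv E) (crd_y u)"
    "d_z K u = poly C (crd_y u)" for u
  proof -
    obtain x y z where u: "u = (x, y, z)" by (cases u)
    show "d_x K u = 0" by (simp add: u d_x_def K_def)
    have "((\<lambda>s. poly C s * z + poly E s) has_field_derivative
        poly (pderiv C) y * z + poly (pderiv E) y) (at y)"
      by (intro DERIV_add DERIV_cmult_right poly_DERIV)
    then show "d_y K u = poly (pderiv C) (crd_y u) * crd_z u + poly (pderiv E) (crd_y u)"
      by (simp add: u d_y_def K_def DERIV_imp_deriv)
    have "((\<lambda>s. poly C y * s + poly E y) has_field_derivative poly C y * 1 + 0) (at z)"
      by (intro DERIV_add DERIV_cmult DERIV_ident DERIV_const)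
    then show "d_z K u = poly C (crd_y u)"
      by (simp add: u d_z_def K_def DERIV_imp_deriv)
  qed
  have cd: "d_x crd_y u = 0" "d_y crd_y u = 1" "d_z crd_y u = 0"
    "d_x crd_z u = 0" "d_y crd_z u = 0" "d_z crd_z u = 1" for u
    by (cases u; simp add: d_x_def d_y_def d_z_def)+
  show ?thesis
  proof (intro bexI[OF _ K] ballI conjI)
    fix i assume i: "i \<in> I"
    show "poisson p K crd_y (q i) = a i"
      using c[rule_format, OF i] nz[OF i] by (simp add: poisson_def partials cd C_def)
    show "poisson p K crd_z (q i) = b i"
      using e[rule_format, OF i] nz[OF i] by (simp add: poisson_def partials cd dE)
  qed
qed

subsection \<open>Orbits on tuples of points\<close>

primrec compose_families :: "(nat \<Rightarrow> complex \<Rightarrow> C3 \<Rightarrow> C3) \<Rightarrow> nat \<Rightarrow> (nat \<Rightarrow> complex) \<Rightarrow> C3 \<Rightarrow> C3" where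
  "compose_families h 0 u q = q"
| "compose_families h (Suc n) u q = h n (u n) (compose_families h n u q)"

lemma compose_families_moves:
  assumes "\<And>n. flow_family p (h n)" shows "compose_families h n u \<in> moves p"
proof (induction n)
  case 0
  have "compose_families h 0 u = (\<lambda>q. q)" by (simp add: fun_eq_iff)
  then show ?case by (simp add: moves.ident)
next
  case (Suc n)
  have "compose_families h (Suc n) u = (\<lambda>q. h n (u n) (compose_families h n u q))"
    by (simp add: fun_eq_iff)
  then show ?case using moves_comp[OF flow_family_moves[OF assms] Suc] by simp
qed

lemma compose_families_polyfun:
  assumes "\<And>n. flow_family p (h n)" "n \<le> N" "f \<in> polyfun xyz"
  shows "(\<lambda>u. f (compose_families h n u q)) \<in> polyfun (coords N)"
  using assms(2,3)
proof (induction n arbitrary: f)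
  case 0
  then show ?case by (simp add: polyfun.const)
next
  case (Suc n)
  have "(\<lambda>u. f (h n (u n) (compose_families h n u q))) \<in> polyfun (coords N)"
  proof (rule flow_family_subst[OF assms(1) Suc.prems(2), of "\<lambda>u. u n" _ "\<lambda>u. compose_families h n u q"])
    show "(\<lambda>u. u n) \<in> polyfun (coords N)"
      using Suc.prems by (intro polyfun.base) (auto simp: coords_def)
    show "(\<lambda>u. g (compose_families h n u q)) \<in> polyfun (coords N)" if "g \<in> polyfun xyz" for g
      using Suc.IH that Suc.prems by simp
  qed
  then show ?case by simp
qed

text \<open>On a coordinate axis of the time space all families but one are the identity, so the
  partial derivatives of the composite at time zero are the velocities of the single
  families.\<close>

lemma compose_families_single:
  assumes "\<And>n. flow_family p (h n)"
  shows "compose_families h n (\<lambda>i. if i = j then s else 0) q = (if j < n then h j s q else q)"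
  by (induction n) (auto simp: flow_family_0[OF assms] less_Suc_eq)

definition generic :: "complex poly \<Rightarrow> nat \<Rightarrow> (nat \<Rightarrow> C3) \<Rightarrow> bool" where
  "generic p m q \<longleftrightarrow> (\<forall>i<m. q i \<in> Zp p \<and> crd_y (q i) \<noteq> 0) \<and> inj_on (\<lambda>i. crd_y (q i)) {..<m}"

text \<open>Where \<open>y\<close> is nonzero, \<open>x = p z / y\<close>. Hence
  \<open>2 * m\<close> functions control \<open>m\<close> points.\<close>

lemma Zp_eqI:
  assumes "q \<in> Zp p" "r \<in> Zp p" "crd_y q = crd_y r" "crd_z q = crd_z r" "crd_y r \<noteq> 0"
  shows "q = r"
proof -
  have "crd_x q * crd_y q = crd_x r * crd_y q"
    using assms by (cases q; cases r) (auto simp: Zp_def)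
  then show ?thesis using assms by (cases q; cases r) auto
qed

text \<open>Family \<open>k\<close> is chosen with velocity the \<open>k\<close>-th unit vector in
  the coordinates \<open>y, z\<close> of all points. The composite of the \<open>2 * m\<close>
  families then has the identity as its Jacobian at time zero, as
  \<open>polyfun_locally_surjective\<close> expects.\<close>

lemma generic_orbit_open:
  assumes d: "degree p \<ge> 2" and q: "generic p m q"
  shows "\<exists>\<epsilon>>0. \<forall>r. generic p m r \<longrightarrow>
    (\<forall>i<m. cmod (crd_y (r i) - crd_y (q i)) < \<epsilon> \<and> cmod (crd_z (r i) - crd_z (q i)) < \<epsilon>) \<longrightarrow>
    (\<exists>g\<in>moves p. \<forall>i<m. g (q i) = r i)"
proof -
  \<comment> \<open>Index \<open>2 * i\<close> stands for the \<open>y\<close>-coordinate and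
    \<open>2 * i + 1\<close> for the \<open>z\<close>-coordinate of point \<open>i\<close>,
    recovered as \<open>k div 2\<close>.\<close>
  define cf where "cf = (\<lambda>k::nat. if even k then crd_y else crd_z)"
  have cf: "cf k \<in> polyfun xyz" for k by (simp add: cf_def polyfun_crd)
  have "\<exists>h. flow_family p h \<and> (\<forall>l<2 * m. ((\<lambda>s. cf l (h s (q (l div 2)))) has_field_derivative
      (if l = k then 1 else 0)) (at 0))" for k
  proof -
    have "\<exists>K\<in>hamiltonians p. \<forall>i\<in>{..<m}. poisson p K crd_y (q i) = (if 2 * i = k then 1 else 0)
        \<and> poisson p K crd_z (q i) = (if Suc (2 * i) = k then 1 else 0)"
      using q by (intro hamiltonians_tangent[OF d]) (auto simp: generic_def)
    then obtain K where K: "K \<in> hamiltonians p"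
      "\<forall>i\<in>{..<m}. poisson p K crd_y (q i) = (if 2 * i = k then 1 else 0)
        \<and> poisson p K crd_z (q i) = (if Suc (2 * i) = k then 1 else 0)" by blast
    obtain h where h: "flow_family p h"
      "\<forall>f\<in>polyfun xyz. \<forall>q. ((\<lambda>s. f (h s q)) has_field_derivative poisson p K f q) (at 0)"
      using K(1) unfolding hamiltonians_def by blast
    have poisson: "poisson p K (cf l) (q (l div 2)) = (if l = k then 1 else 0)" if "l < 2 * m" for l
    proof (cases "even l")
      case True
      then obtain i where "l = 2 * i" by (rule evenE)
      then show ?thesis using K(2) that by (simp add: cf_def)
    next
      case False
      then obtain i where "l = 2 * i + 1" by (rule oddE)
      then show ?thesis using K(2) that by (simp add: cf_def)
    qed
    show ?thesis
    proof (intro exI[of _ h] conjI h(1) allI impI)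
      fix l assume "l < 2 * m"
      from h(2)[rule_format, OF cf, of l "q (l div 2)", unfolded poisson[OF this]]
      show "((\<lambda>s. cf l (h s (q (l div 2)))) has_field_derivative (if l = k then 1 else 0)) (at 0)" .
    qed
  qed
  then have "\<forall>k. \<exists>h. flow_family p h \<and> (\<forall>l<2 * m. ((\<lambda>s. cf l (h s (q (l div 2)))) has_field_derivative
      (if l = k then 1 else 0)) (at 0))" ..
  from choice[OF this] obtain h where hh: "\<forall>k. flow_family p (h k) \<and>
    (\<forall>l<2 * m. ((\<lambda>s. cf l (h k s (q (l div 2)))) has_field_derivative
      (if l = k then 1 else 0)) (at 0))" ..
  have h: "flow_family p (h k)" for k
    using hh[rule_format, of k] by (rule conjunct1)
  have Dh: "((\<lambda>s. cf l (h k s (q (l div 2)))) has_field_derivative (if l = k then 1 else 0)) (at 0)"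
    if "l < 2 * m" for k l
    using conjunct2[OF hh[rule_format, of k], rule_format, OF that] .
  define \<Psi> where "\<Psi> = (\<lambda>k u. cf k (compose_families h (2 * m) u (q (k div 2))))"
  have id0: "compose_families h n (\<lambda>_. 0) q' = q'" for n q'
    by (induction n) (simp_all add: flow_family_0[OF h])
  have "\<exists>\<epsilon>>0. \<forall>r. (\<forall>k<2 * m. cmod (r k - \<Psi> k (\<lambda>_. 0)) < \<epsilon>) \<longrightarrow> (\<exists>u. \<forall>k<2 * m. \<Psi> k u = r k)"
  proof (rule polyfun_locally_surjective)
    show "\<Psi> k \<in> polyfun (coords (2 * m))" for k
      unfolding \<Psi>_def by (rule compose_families_polyfun[OF h order_refl cf])
    show "((\<lambda>s. \<Psi> k (\<lambda>i. if i = j then s else 0)) has_field_derivative (if k = j then 1 else 0)) (at 0)"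
      if "k < 2 * m" "j < 2 * m" for k j
      unfolding \<Psi>_def compose_families_single[OF h] using Dh[OF that(1), of j] that(2) by simp
  qed
  then obtain \<epsilon> where \<epsilon>: "\<epsilon> > 0" "\<And>r. \<forall>k<2 * m. cmod (r k - \<Psi> k (\<lambda>_. 0)) < \<epsilon> \<Longrightarrow> \<exists>u. \<forall>k<2 * m. \<Psi> k u = r k"
    by blast
  show ?thesis
  proof (intro exI[of _ \<epsilon>] conjI allI impI \<epsilon>(1))
    fix r assume r: "generic p m r"
      and near: "\<forall>i<m. cmod (crd_y (r i) - crd_y (q i)) < \<epsilon> \<and> cmod (crd_z (r i) - crd_z (q i)) < \<epsilon>"
    have "\<forall>k<2 * m. cmod (cf k (r (k div 2)) - \<Psi> k (\<lambda>_. 0)) < \<epsilon>"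
    proof (intro allI impI)
      fix k assume "k < 2 * m"
      then have "k div 2 < m" by auto
      then show "cmod (cf k (r (k div 2)) - \<Psi> k (\<lambda>_. 0)) < \<epsilon>"
        using near by (simp add: \<Psi>_def id0 cf_def)
    qed
    then obtain u where u: "\<And>k. k < 2 * m \<Longrightarrow> \<Psi> k u = cf k (r (k div 2))" using \<epsilon>(2)[of "\<lambda>k. cf k (r (k div 2))"] by blast
    define g where "g = compose_families h (2 * m) u"
    have g: "g \<in> moves p" unfolding g_def by (rule compose_families_moves[OF h])
    have "g (q i) = r i" if i: "i < m" for i
    proof (rule Zp_eqI)
      show "g (q i) \<in> Zp p" "r i \<in> Zp p" "crd_y (r i) \<noteq> 0"
        using i q r moves_Zp[OF g] by (auto simp: generic_def)
      show "crd_y (g (q i)) = crd_y (r i)" using u[of "2 * i"] i by (simp add: \<Psi>_def cf_def g_def)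
      show "crd_z (g (q i)) = crd_z (r i)" using u[of "2 * i + 1"] i by (simp add: \<Psi>_def cf_def g_def)
    qed
    with g show "\<exists>g\<in>moves p. \<forall>i<m. g (q i) = r i" by blast
  qed
qed

text \<open>Two generic tuples are joined by a complex line in the coordinates \<open>y, z\<close>, which meets the
  nongeneric tuples in finitely many points only.\<close>

lemma generic_transitive:
  assumes d: "degree p \<ge> 2" and q: "generic p m q" and r: "generic p m r"
  shows "\<exists>g\<in>moves p. \<forall>i<m. g (q i) = r i"
proof -
  define Y where "Y = (\<lambda>i s. crd_y (q i) + s * (crd_y (r i) - crd_y (q i)))"
  define Z where "Z = (\<lambda>i s. crd_z (q i) + s * (crd_z (r i) - crd_z (q i)))"
  \<comment> \<open>The \<open>x\<close>-coordinate is forced by the equation of the surface.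
    Parameters with \<open>Y i s = 0\<close>, where the division returns 0, are excluded from
    \<open>S\<close> by genericity.\<close>
  define pt where "pt = (\<lambda>s i. (poly p (Z i s) / Y i s, Y i s, Z i s))"
  define S where "S = {s. generic p m (pt s)}"
  have S_iff: "s \<in> S \<longleftrightarrow> (\<forall>i<m. Y i s \<noteq> 0) \<and> (\<forall>i<m. \<forall>j<m. i \<noteq> j \<longrightarrow> Y i s - Y j s \<noteq> 0)" for s
    by (auto simp: S_def generic_def pt_def Zp_def inj_on_def)
  have lin: "finite {s. a + s * b = 0}" if "a \<noteq> 0" for a b :: complex
  proof (rule finite_subset)
    show "{s. a + s * b = 0} \<subseteq> {- a / b}"
    proof clarsimp
      fix s assume "a + s * b = 0"
      moreover from this have "b \<noteq> 0" using that by auto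
      ultimately show "s = - (a / b)" by (simp add: field_simps add_eq_0_iff)
    qed
  qed simp
  define F where "F = (\<Union>i<m. {s. Y i s = 0}) \<union> (\<Union>i<m. \<Union>j\<in>{..<m} - {i}. {s. Y i s - Y j s = 0})"
  have "finite {s. Y i s - Y j s = 0}" if "i < m" "j < m" "i \<noteq> j" for i j
  proof -
    have "crd_y (q i) - crd_y (q j) \<noteq> 0" using q that by (auto simp: generic_def inj_on_def)
    from lin[OF this, of "crd_y (r i) - crd_y (q i) - (crd_y (r j) - crd_y (q j))"]
    show ?thesis by (simp add: Y_def algebra_simps)
  qed
  moreover have "finite {s. Y i s = 0}" if "i < m" for i
    unfolding Y_def using q that by (intro lin) (auto simp: generic_def)
  ultimately have "finite F" unfolding F_def by (intro finite_UnI finite_UN_I) auto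
  \<comment> \<open>This is why a complex parameter is used: finitely many points do not disconnect
    the plane, whereas they would cut a real segment.\<close>
  then have "connected (UNIV - F)"
    by (intro connected_open_delete_finite) auto
  also have "UNIV - F = S"
  proof (intro Set.set_eqI iffI)
    fix s assume s: "s \<in> UNIV - F"
    have "Y i s \<noteq> 0" if "i < m" for i using s that by (simp add: F_def)
    moreover have "Y i s - Y j s \<noteq> 0" if "i < m" "j < m" "i \<noteq> j" for i j
      using s that unfolding F_def by fastforce
    ultimately show "s \<in> S" unfolding S_iff by simp
  next
    fix s assume "s \<in> S"
    then have s: "\<And>i. i < m \<Longrightarrow> Y i s \<noteq> 0"
      "\<And>i j. i < m \<Longrightarrow> j < m \<Longrightarrow> i \<noteq> j \<Longrightarrow> Y i s - Y j s \<noteq> 0" unfolding S_iff by simp_all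
    then show "s \<in> UNIV - F" unfolding F_def by fastforce
  qed
  finally have conn: "connected S" .
  define R where "R = (\<lambda>s t. \<exists>g\<in>moves p. \<forall>i<m. g (pt s i) = pt t i)"
  have end0: "pt 0 i = q i" if "i < m" for i
    using q that by (intro Zp_eqI[of _ p]) (auto simp: pt_def Y_def Z_def generic_def Zp_def)
  have end1: "pt 1 i = r i" if "i < m" for i
    using r that by (intro Zp_eqI[of _ p]) (auto simp: pt_def Y_def Z_def generic_def Zp_def)
  have "R 0 1"
  proof (rule connected_equivalence_relation[OF conn])
    show "0 \<in> S" "1 \<in> S"
      using q r by (auto simp: S_iff Y_def generic_def inj_on_def)
    show "R t s" if st: "R s t" for s t
    proof -
      obtain g where g: "g \<in> moves p" "\<forall>i<m. g (pt s i) = pt t i" using st unfolding R_def by blast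
      obtain h where h: "h \<in> moves p" "\<And>q. h (g q) = q" "\<And>q. g (h q) = q"
        using moves_inverse[OF g(1)] by blast
      have "h (pt t i) = pt s i" if "i < m" for i
        using h(2)[of "pt s i"] unfolding g(2)[rule_format, OF that] .
      then show ?thesis unfolding R_def by (intro bexI[OF _ h(1)]) simp
    qed
    show "R s v" if st: "R s t" and tv: "R t v" for s t v
    proof -
      obtain g where g: "g \<in> moves p" "\<forall>i<m. g (pt s i) = pt t i" using st unfolding R_def by blast
      obtain h where h: "h \<in> moves p" "\<forall>i<m. h (pt t i) = pt v i" using tv unfolding R_def by blast
      have "h (g (pt s i)) = pt v i" if "i < m" for i
        unfolding g(2)[rule_format, OF that] h(2)[rule_format, OF that] ..
      then show ?thesis unfolding R_def by (intro bexI[OF _ moves_comp[OF h(1) g(1)]]) simp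
    qed
    \<comment> \<open>Openness of the classes: for \<open>s\<close> near \<open>a\<close> the
      coordinates \<open>Y i s\<close> and \<open>Z i s\<close> are close to those at
      \<open>a\<close>, so \<open>generic_orbit_open\<close> applies.\<close>
    fix a assume a: "a \<in> S"
    obtain \<epsilon> where \<epsilon>: "\<epsilon> > 0" "\<And>r. generic p m r \<Longrightarrow>
      \<forall>i<m. cmod (crd_y (r i) - crd_y (pt a i)) < \<epsilon> \<and> cmod (crd_z (r i) - crd_z (pt a i)) < \<epsilon> \<Longrightarrow>
      \<exists>g\<in>moves p. \<forall>i<m. g (pt a i) = r i"
      using generic_orbit_open[OF d, of m "pt a"] a unfolding S_def by blast
    define T where "T = (\<Inter>i<m. {s. cmod (Y i s - Y i a) < \<epsilon>} \<inter> {s. cmod (Z i s - Z i a) < \<epsilon>})"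
    have "open T" unfolding T_def Y_def Z_def
      by (intro open_INT ballI open_Int open_Collect_less continuous_intros) auto
    then have "openin (top_of_set S) (S \<inter> T)" by (rule openin_open_Int)
    moreover have "a \<in> S \<inter> T" using a \<epsilon>(1) by (simp add: T_def)
    moreover have "R a s" if "s \<in> S \<inter> T" for s
      unfolding R_def using that by (intro \<epsilon>(2)) (auto simp: S_def T_def pt_def)
    ultimately show "\<exists>T. openin (top_of_set S) T \<and> a \<in> T \<and> (\<forall>x\<in>T. R a x)" by blast
  qed
  then obtain g where g: "g \<in> moves p" "\<forall>i<m. g (pt 0 i) = pt 1 i" unfolding R_def by blast
  have "g (q i) = r i" if "i < m" for i
    using g(2)[rule_format, OF that] unfolding end0[OF that] end1[OF that] .
  then show ?thesis by (intro bexI[OF _ g(1)]) simp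
qed

section \<open>Moving arbitrary tuples into generic position\<close>

lemma polyfun_along_curve:
  assumes "f \<in> polyfun B" "\<And>b. b \<in> B \<Longrightarrow> \<exists>r. \<forall>s. b (\<gamma> s) = poly r s"
  shows "\<exists>r. \<forall>s. f (\<gamma> s) = poly r s"
  using assms
proof (induction rule: polyfun.induct)
  case (const c)
  show ?case by (rule exI[of _ "[:c:]"]) simp
next
  case (add f g)
  then obtain r r' where "\<forall>s. f (\<gamma> s) = poly r s" "\<forall>s. g (\<gamma> s) = poly r' s" by blast
  then show ?case by (intro exI[of _ "r + r'"]) simp
next
  case (mult f g)
  then obtain r r' where "\<forall>s. f (\<gamma> s) = poly r s" "\<forall>s. g (\<gamma> s) = poly r' s" by blast
  then show ?case by (intro exI[of _ "r * r'"]) simp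
qed

lemma polyfun_prod:
  assumes "\<And>i. i \<in> I \<Longrightarrow> f i \<in> polyfun B" shows "(\<lambda>u. \<Prod>i\<in>I. f i u) \<in> polyfun B"
  using assms
  by (induction I rule: infinite_finite_induct) (auto intro: polyfun.const polyfun.mult)

text \<open>On the line joining a point good for \<open>I\<close> to a point good for
  \<open>j\<close> all functions become univariate polynomials, and a product of nonzero ones has a
  nonroot. This reduces general position to one witness per condition.\<close>

lemma polyfun_common_nonzero:
  assumes "finite I" "\<And>i. i \<in> I \<Longrightarrow> f i \<in> polyfun {fst, snd}"
    "\<And>i. i \<in> I \<Longrightarrow> \<exists>w. f i w \<noteq> (0 :: complex)"
  shows "\<exists>w :: complex \<times> complex. \<forall>i\<in>I. f i w \<noteq> 0"
  using assms
proof (induction I rule: finite_induct)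
  case (insert j I)
  then obtain v where v: "\<forall>i\<in>I. f i v \<noteq> 0" by auto
  obtain w where w: "f j w \<noteq> 0" using insert.prems(2)[of j] by blast
  define \<gamma> where "\<gamma> = (\<lambda>s. (fst v + s * (fst w - fst v), snd v + s * (snd w - snd v)))"
  have \<gamma>: "\<gamma> 0 = v" "\<gamma> 1 = w" by (simp_all add: \<gamma>_def)
  have "\<exists>r. \<forall>s. b (\<gamma> s) = poly r s" if "b \<in> {fst, snd}" for b
    using that by (auto simp: \<gamma>_def intro: exI[of _ "[:fst v, fst w - fst v:]"] exI[of _ "[:snd v, snd w - snd v:]"])
  then have ex: "\<exists>r. \<forall>s. g (\<gamma> s) = poly r s" if "g \<in> polyfun {fst, snd}" for g
    using polyfun_along_curve[OF that] by blast
  define g where "g = (\<lambda>w. \<Prod>i\<in>I. f i w)"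
  have "g \<in> polyfun {fst, snd}"
    unfolding g_def using insert.prems(1) by (intro polyfun_prod) simp
  then obtain r where r: "\<forall>s. g (\<gamma> s) = poly r s" using ex by blast
  obtain r' where r': "\<forall>s. f j (\<gamma> s) = poly r' s" using ex insert.prems(1) by blast
  have "g v \<noteq> 0" using v insert.hyps by (simp add: g_def)
  then have "poly r 0 \<noteq> 0" using r[rule_format, of 0] by (simp add: \<gamma>)
  moreover have "poly r' 1 \<noteq> 0" using r'[rule_format, of 1] w by (simp add: \<gamma>)
  ultimately have "r * r' \<noteq> 0" by auto
  then obtain s where "poly (r * r') s \<noteq> 0" using poly_all_0_iff_0 by blast
  then have "g (\<gamma> s) \<noteq> 0" "f j (\<gamma> s) \<noteq> 0" using r r' by auto
  then show ?case using insert.hyps by (intro exI[of _ "\<gamma> s"]) (auto simp: g_def)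
qed auto

text \<open>A period \<open>c\<close> would make all multiples \<open>n * c\<close> roots of
  \<open>p - p 0\<close>, too many for a nonconstant polynomial.\<close>

lemma not_periodic:
  fixes p :: "complex poly"
  assumes "degree p \<ge> 1" "c \<noteq> 0"
  shows "\<exists>w. poly p (w + c) \<noteq> poly p w"
proof (rule ccontr)
  assume "\<not> ?thesis"
  then have per: "poly p (w + c) = poly p w" for w by blast
  have "poly p (of_nat n * c) = poly p 0" for n
  proof (induction n)
    case (Suc n)
    have "poly p (of_nat (Suc n) * c) = poly p (of_nat n * c + c)" by (simp add: algebra_simps)
    then show ?case using per Suc by metis
  qed simp
  then have "range (\<lambda>n. of_nat n * c) \<subseteq> {w. poly (p - [:poly p 0:]) w = 0}" by auto
  moreover have "inj (\<lambda>n. of_nat n * c)" using assms(2) by (auto simp: inj_on_def)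
  then have "infinite (range (\<lambda>n. of_nat n * c))" by (rule range_inj_infinite)
  ultimately have "p - [:poly p 0:] = 0" using poly_roots_finite finite_subset by blast
  then have "p = [:poly p 0:]" by simp
  then have "degree p = 0" by (metis degree_pCons_0)
  with assms show False by simp
qed

lemma move_x_nonzero:
  fixes q :: "nat \<Rightarrow> C3"
  assumes "degree p \<ge> 1" "rsquarefree p" "\<And>i. i < m \<Longrightarrow> q i \<in> Zp p"
  shows "\<exists>g\<in>moves p. \<forall>i<m. crd_x (g (q i)) \<noteq> 0"
proof -
  define f where "f = (\<lambda>i (w :: complex \<times> complex). crd_x (vflow p (fst w) 0 (q i)))"
  have "\<exists>w. \<forall>i\<in>{..<m}. f i w \<noteq> 0"
  proof (rule polyfun_common_nonzero)
    show "f i \<in> polyfun {fst, snd}" for i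
      unfolding f_def crd_vflow
      by (intro polyfun.add polyfun_diff_quot polyfun.mult polyfun.const polyfun.base) simp
    fix i assume i: "i \<in> {..<m}"
    obtain x y z where q: "q i = (x, y, z)" by (cases "q i")
    have xy: "x * y = poly p z" using assms(3)[of i] i by (simp add: q Zp_def)
    show "\<exists>w. f i w \<noteq> 0"
    proof (cases "y = 0")
      case True
      \<comment> \<open>Here \<open>p z = x y = 0\<close>, so \<open>z\<close> is a simple zero. At
        \<open>y = 0\<close> the flow is \<open>x + t * p' z\<close>, and the time below makes this
        equal to 1.\<close>
      then have "poly (pderiv p) z \<noteq> 0" using assms(2) xy by (auto simp: rsquarefree_roots)
      then show ?thesis using True
        by (intro exI[of _ "((1 - x) / poly (pderiv p) z, 0)"]) (simp add: f_def crd_vflow q diff_quot_0)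
    next
      case False
      have "p \<noteq> 0" using assms(1) by auto
      then obtain w where "poly p w \<noteq> 0" using poly_all_0_iff_0 by blast
      \<comment> \<open>Since \<open>x y = p z\<close>, the new \<open>x\<close>-coordinate is
        \<open>p (z + t * y) / y\<close>; the time moves \<open>z\<close> to the nonroot
        \<open>w\<close>.\<close>
      then show ?thesis using False xy
        by (intro exI[of _ "((w - z) / y, 0)"]) (simp add: f_def crd_vflow q diff_quot_eq field_simps)
    qed
  qed simp
  then obtain w where "\<forall>i<m. f i w \<noteq> 0" by auto
  then show ?thesis unfolding f_def by (intro bexI[OF _ vflow_moves]) auto
qed

text \<open>With \<open>x\<close> nonzero, the flow of \<open>(a + b x) W\<close> makes the
  \<open>y\<close>-coordinate \<open>p (z + (a + b x) x) / x\<close>. Each condition needs just one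
  good pair \<open>(a, b)\<close>, found separately by
  \<open>polyfun_common_nonzero\<close>.\<close>

lemma move_y_generic:
  fixes q :: "nat \<Rightarrow> C3"
  assumes d: "degree p \<ge> 1" and Z: "\<And>i. i < m \<Longrightarrow> q i \<in> Zp p"
    and x: "\<And>i. i < m \<Longrightarrow> crd_x (q i) \<noteq> 0" and inj: "inj_on q {..<m}"
  shows "\<exists>g\<in>moves p. generic p m (\<lambda>i. g (q i))"
proof -
  define F where "F = (\<lambda>i w. crd_y (wflow p (fst w) (snd w) (q i)))"
  \<comment> \<open>The diagonal entries encode that \<open>y\<close>-coordinates are nonzero, the
    others that they are distinct, so one family covers both.\<close>
  define f where "f = (\<lambda>(i, j) w. F i w - (if i = j then 0 else F j w))"
  have F: "F i \<in> polyfun {fst, snd}" for i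
    unfolding F_def wflow_def crd_vflow crd_swap
    by (intro polyfun.add polyfun_diff_quot polyfun.mult polyfun.const polyfun.base) auto
  have F_eq: "F i (a, b) = poly p (crd_z (q i) + (a + b * crd_x (q i)) * crd_x (q i)) / crd_x (q i)"
    if "i < m" for i a b
  proof -
    obtain x' y' z' where q: "q i = (x', y', z')" by (cases "q i")
    have "x' \<noteq> 0" "x' * y' = poly p z'" using Z[OF that] x[OF that] by (simp_all add: q Zp_def)
    then show ?thesis by (simp add: F_def wflow_def crd_vflow crd_swap q diff_quot_eq field_simps)
  qed
  have "p \<noteq> 0" using d by auto
  then obtain w0 where w0: "poly p w0 \<noteq> 0" using poly_all_0_iff_0 by blast
  obtain r0 where r0: "poly p r0 = 0" using alg_closed_imp_poly_has_root[of p] d by auto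
  have "\<exists>w. \<forall>ij\<in>{..<m} \<times> {..<m}. f ij w \<noteq> 0"
  proof (rule polyfun_common_nonzero)
    show "f ij \<in> polyfun {fst, snd}" for ij
      by (cases ij; cases "fst ij = snd ij") (simp_all add: f_def F polyfun_diff)
    fix ij assume "ij \<in> {..<m} \<times> {..<m}"
    then obtain i j where ij: "ij = (i, j)" "i < m" "j < m" by auto
    define xi where "xi = crd_x (q i)"
    define xj where "xj = crd_x (q j)"
    define zi where "zi = crd_z (q i)"
    define zj where "zj = crd_z (q j)"
    have Fi: "F i (a, b) = poly p (zi + (a + b * xi) * xi) / xi" for a b
      using F_eq[OF ij(2)] by (simp add: xi_def zi_def)
    have Fj: "F j (a, b) = poly p (zj + (a + b * xj) * xj) / xj" for a b
      using F_eq[OF ij(3)] by (simp add: xj_def zj_def)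
    have nz: "xi \<noteq> 0" "xj \<noteq> 0" using x ij by (auto simp: xi_def xj_def)
    consider "i = j" | "i \<noteq> j" "xi \<noteq> xj" | "i \<noteq> j" "xi = xj" by blast
    then show "\<exists>w. f ij w \<noteq> 0"
    proof cases
      case 1
      then show ?thesis using nz w0
        by (intro exI[of _ "((w0 - zj) / xj, 0)"]) (simp add: f_def ij(1) Fj)
    next
      case 2
      \<comment> \<open>For distinct \<open>x\<close>-coordinates the times
        \<open>a + b * xi\<close> and \<open>a + b * xj\<close> can be prescribed independently.
        They send \<open>zi\<close> to a root and \<open>zj\<close> to a nonroot, so exactly one of
        the two \<open>y\<close>-coordinates vanishes.\<close>
      define \<alpha> where "\<alpha> = (r0 - zi) / xi"
      define \<beta> where "\<beta> = (w0 - zj) / xj"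
      define b where "b = (\<alpha> - \<beta>) / (xi - xj)"
      define a where "a = \<alpha> - b * xi"
      have "b * (xi - xj) = \<alpha> - \<beta>" using 2 by (simp add: b_def)
      then have "a + b * xi = \<alpha>" "a + b * xj = \<beta>" by (simp_all add: a_def algebra_simps)
      then have "f ij (a, b) = - poly p w0 / xj"
        using 2(1) nz by (simp add: f_def ij Fi Fj r0 \<alpha>_def \<beta>_def)
      then show ?thesis using w0 nz by (intro exI[of _ "(a, b)"]) simp
    next
      case 3
      \<comment> \<open>Equal \<open>x\<close>-coordinates shift both \<open>z\<close>-coordinates
        by the same amount, so only their difference can separate the points: if no shift did, it
        would be a period of \<open>p\<close>.\<close>
      have "zi \<noteq> zj"
      proof
        assume eq: "zi = zj"
        obtain x1 y1 z1 where q1: "q i = (x1, y1, z1)" by (cases "q i")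
        obtain x2 y2 z2 where q2: "q j = (x2, y2, z2)" by (cases "q j")
        have "x1 * y1 = poly p z1" "x2 * y2 = poly p z2"
          using Z[OF ij(2)] Z[OF ij(3)] by (simp_all add: q1 q2 Zp_def)
        moreover have "x1 = x2" "z1 = z2" "x1 \<noteq> 0"
          using 3 eq nz by (simp_all add: xi_def xj_def zi_def zj_def q1 q2)
        ultimately have "q i = q j" by (metis q1 q2 mult_left_cancel)
        then show False using inj ij 3(1) by (auto simp: inj_on_def)
      qed
      then obtain w where w: "poly p (w + (zi - zj)) \<noteq> poly p w"
        using not_periodic[OF d, of "zi - zj"] by auto
      have eq: "zi + (w - zj) = w + (zi - zj)" by simp
      have "f ij ((w - zj) / xi, 0) = (poly p (zi + (w - zj)) - poly p w) / xi"
        using 3 nz by (simp add: f_def ij Fi Fj flip: diff_divide_distrib)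
      then show ?thesis using w nz unfolding eq by (intro exI[of _ "((w - zj) / xi, 0)"]) simp
    qed
  qed simp
  then obtain w where w: "\<And>i j. i < m \<Longrightarrow> j < m \<Longrightarrow> f (i, j) w \<noteq> 0" by auto
  define g where "g = wflow p (fst w) (snd w)"
  have g: "g \<in> moves p" by (simp add: g_def wflow_moves)
  have "generic p m (\<lambda>i. g (q i))" unfolding generic_def
  proof (intro conjI allI impI inj_onI)
    show "g (q i) \<in> Zp p" if "i < m" for i using moves_Zp[OF g Z[OF that]] .
    show "crd_y (g (q i)) \<noteq> 0" if "i < m" for i
      using w[OF that that] by (simp add: f_def F_def g_def)
    show "i = j" if "i \<in> {..<m}" "j \<in> {..<m}" "crd_y (g (q i)) = crd_y (g (q j))" for i j
      using w[of i j] that by (auto simp: f_def F_def g_def split: if_splits)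
  qed
  with g show ?thesis by blast
qed

lemma move_generic:
  assumes "degree p \<ge> 1" "rsquarefree p" "\<And>i. i < m \<Longrightarrow> q i \<in> Zp p" "inj_on q {..<m}"
  shows "\<exists>g\<in>moves p. generic p m (\<lambda>i. g (q i))"
proof -
  obtain g where g: "g \<in> moves p" "\<forall>i<m. crd_x (g (q i)) \<noteq> 0"
    using move_x_nonzero[OF assms(1,2), of m q] assms(3) by blast
  obtain g' where g': "g' \<in> moves p" "\<And>q. g' (g q) = q" "\<And>q. g (g' q) = q"
    using moves_inverse[OF g(1)] by blast
  have "inj_on (\<lambda>i. g (q i)) {..<m}"
  proof (rule inj_onI)
    fix i j assume ij: "i \<in> {..<m}" "j \<in> {..<m}" "g (q i) = g (q j)"
    from arg_cong[OF ij(3), of g'] have "q i = q j" by (simp only: g'(2))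
    with assms(4) ij show "i = j" by (simp only: inj_on_eq_iff)
  qed
  from move_y_generic[OF assms(1) moves_Zp[OF g(1) assms(3)] g(2)[rule_format] this]
  obtain h where h: "h \<in> moves p" "generic p m (\<lambda>i. h (g (q i)))" by auto
  show ?thesis by (rule bexI[OF _ moves_comp[OF h(1) g(1)]]) (rule h(2))
qed

theorem theorem4p11:
  fixes p :: "complex poly"
  assumes "degree p \<ge> 2"
    and "rsquarefree p"
  shows "infinitely_transitive (flow_group p) (Zp_reg p)"
  unfolding infinitely_transitive_def m_transitive_def Zp_reg_eq[OF assms(2)]
proof (intro allI impI, elim conjE)
  fix m and as bs :: "C3 list"
  assume as: "length as = m" "distinct as" "set as \<subseteq> Zp p"
    and bs: "length bs = m" "distinct bs" "set bs \<subseteq> Zp p"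
  have d1: "degree p \<ge> 1" using assms(1) by simp
  have gen: "\<exists>g\<in>moves p. generic p m (\<lambda>i. g (cs ! i))"
    if "length cs = m" "distinct cs" "set cs \<subseteq> Zp p" for cs
    using that by (intro move_generic[OF d1 assms(2)]) (auto simp: inj_on_def nth_eq_iff_index_eq)
  obtain g where g: "g \<in> moves p" "generic p m (\<lambda>i. g (as ! i))" using gen[OF as] by blast
  obtain h where h: "h \<in> moves p" "generic p m (\<lambda>i. h (bs ! i))" using gen[OF bs] by blast
  obtain k where k: "k \<in> moves p" "\<forall>i<m. k (g (as ! i)) = h (bs ! i)"
    using generic_transitive[OF assms(1) g(2) h(2)] by blast
  obtain h' where h': "h' \<in> moves p" "\<And>q. h' (h q) = q" "\<And>q. h (h' q) = q"
    using moves_inverse[OF h(1)] by blast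
  \<comment> \<open>The generic positions of both tuples are joined by \<open>k\<close>, and
    \<open>h'\<close> returns from the generic position of \<open>bs\<close> to \<open>bs\<close>
    itself.\<close>
  define f where "f = (\<lambda>q. h' (k (g q)))"
  have "f \<in> moves p" unfolding f_def by (rule moves_comp[OF h'(1) moves_comp[OF k(1) g(1)]])
  then have "restrict f (Zp p) \<in> flow_group p" by (rule moves_flow_group)
  moreover have "map (restrict f (Zp p)) as = bs"
  proof (rule nth_equalityI)
    fix i assume "i < length (map (restrict f (Zp p)) as)"
    then have i: "i < m" using as by simp
    then have "as ! i \<in> Zp p" using as nth_mem by blast
    moreover have "f (as ! i) = bs ! i" unfolding f_def k(2)[rule_format, OF i] h'(2) ..
    ultimately show "map (restrict f (Zp p)) as ! i = bs ! i" using i as(1) by simp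
  qed (simp add: as bs)
  ultimately show "\<exists>g\<in>flow_group p. map g as = bs"
    by (intro bexI[of _ "restrict f (Zp p)"])
qed

end
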